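(* Let $K\in\{-1,0,+1\}$, let $g_0$ be the standard round metric on $S^3$ (sectional curvature $1$), and let $\bar g(t)=f(t)^2 g_0$ be a family of round metrics on $S^3$, where $f:[0,T)\to\mathbb{R}$ is smooth, $f>0$ on $(0,T)$, $0<T\le\infty$. Suppose that for all $t\in(0,T)$ the conformal factor evolves by the flow $$\dot f=\sqrt{f_{Ric}-4K},$$ where $\dot f:=\dfrac{\partial_t\bar g}{\bar g}=2\dfrac{f'}{f}$ and $f_{Ric}:=\dfrac{\overline{Ric}}{\bar g}=\dfrac{4}{f^2}$ (in particular the expression under the root is nonnegative). If $f(0)=0$ and $f'(0)=1$, then the metric $$g=dt^2+\bar g(t)=dt^2+f(t)^2g_0$$ on $(0,T)\times S^3$ is a metric of constant sectional curvature $K$.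
   Context: $\overline{Ric}$ denotes the Ricci tensor of $\bar g(t)$ on $S^3$. The normalization used is that the curvature $2$-form in an orthonormal coframe $\{\varepsilon^i\}$ is written (for diagonal curvature) as $\bar\Omega^i_j=\frac12\bar R^i_{jij}\,\varepsilon^i\wedge\varepsilon^j$ with no summation, so that $\overline{Ric}$ is twice the usual Ricci tensor; hence for $\bar g=f^2g_0$ one has $\overline{Ric}=\frac{4}{f^2}\bar g$. Both $\partial_t\bar g$ and $\overline{Ric}$ are scalar multiples of $\bar g$, and the quotients in the claim denote these scalars. A prime denotes $d/dt$. "Constant curvature $K$" refers to the usual sectional curvature. *)

theory Defs
  imports "HOL-Analysis.Analysis"
begin

section \<open>Smooth functions\<close>

text \<open>Only meant for open sets \<open>S\<close>, since the derivative is the two-sided one.\<close>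

primrec continuously_differentiable_on ::
  "nat \<Rightarrow> 'a::real_normed_vector set \<Rightarrow> ('a \<Rightarrow> 'b::real_normed_vector) \<Rightarrow> bool" where
  "continuously_differentiable_on 0 S h \<longleftrightarrow> continuous_on S h"
| "continuously_differentiable_on (Suc k) S h \<longleftrightarrow>
     (\<forall>x\<in>S. h differentiable (at x)) \<and>
     (\<forall>v. continuously_differentiable_on k S (\<lambda>x. frechet_derivative h (at x) v))"

definition smooth_on :: "'a::real_normed_vector set \<Rightarrow> ('a \<Rightarrow> 'b::real_normed_vector) \<Rightarrow> bool" where
  "smooth_on S h \<longleftrightarrow> (\<forall>k. continuously_differentiable_on k S h)"

text \<open>Functions on an interval \<open>I\<close>; the derivatives are one-sided at an endpoint belonging to \<open>I\<close>.\<close>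

definition smooth_on_interval :: "real set \<Rightarrow> (real \<Rightarrow> real) \<Rightarrow> bool" where
  "smooth_on_interval I f \<longleftrightarrow>
     (\<exists>D. D 0 = f \<and>
          (\<forall>n. \<forall>t\<in>I. (D n has_real_derivative D (Suc n) t) (at t within I)))"


section \<open>Riemannian geometry in coordinates\<close>

definition partial_derivative ::
  "'n::finite \<Rightarrow> (real^'n \<Rightarrow> 'b::real_normed_vector) \<Rightarrow> real^'n \<Rightarrow> 'b" where
  "partial_derivative i h x = frechet_derivative h (at x) (axis i 1)"

text \<open>\<open>christoffel G x k i j\<close> is \<open>\<Gamma>\<^sup>k\<^sub>i\<^sub>j(x)\<close> for the metric with coefficient matrix \<open>G\<close>.\<close>

definition christoffel ::
  "(real^'n \<Rightarrow> real^'n^'n) \<Rightarrow> real^'n \<Rightarrow> 'n::finite \<Rightarrow> 'n \<Rightarrow> 'n \<Rightarrow> real" where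
  "christoffel G x k i j =
     (1/2) * (\<Sum>l\<in>UNIV. matrix_inv (G x) $ k $ l *
        (partial_derivative i (\<lambda>y. G y $ j $ l) x
         + partial_derivative j (\<lambda>y. G y $ i $ l) x
         - partial_derivative l (\<lambda>y. G y $ i $ j) x))"

text \<open>Index order: \<open>R(\<partial>\<^sub>i, \<partial>\<^sub>j) \<partial>\<^sub>k = (\<Sum>l. riemann G x l k i j \<partial>\<^sub>l)\<close>, where
  \<open>R(X,Y) = \<nabla>\<^sub>X \<nabla>\<^sub>Y - \<nabla>\<^sub>Y \<nabla>\<^sub>X - \<nabla>\<^bsub>[X,Y]\<^esub>\<close>.\<close>

definition riemann ::
  "(real^'n \<Rightarrow> real^'n^'n) \<Rightarrow> real^'n \<Rightarrow> 'n::finite \<Rightarrow> 'n \<Rightarrow> 'n \<Rightarrow> 'n \<Rightarrow> real" where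
  "riemann G x l k i j =
     partial_derivative i (\<lambda>y. christoffel G y l j k) x
     - partial_derivative j (\<lambda>y. christoffel G y l i k) x
     + (\<Sum>m\<in>UNIV. christoffel G x l i m * christoffel G x m j k
                 - christoffel G x l j m * christoffel G x m i k)"

definition curvature_operator ::
  "(real^'n \<Rightarrow> real^'n^'n) \<Rightarrow> real^'n \<Rightarrow> real^'n \<Rightarrow> real^'n \<Rightarrow> real^'n \<Rightarrow> real^'n::finite" where
  "curvature_operator G x u v w =
     (\<chi> l. \<Sum>k\<in>UNIV. \<Sum>i\<in>UNIV. \<Sum>j\<in>UNIV. riemann G x l k i j * u $ i * v $ j * w $ k)"

definition sectional_curvature ::
  "(real^'n \<Rightarrow> real^'n^'n) \<Rightarrow> real^'n \<Rightarrow> real^'n \<Rightarrow> real^'n::finite \<Rightarrow> real" where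
  "sectional_curvature G x u v =
     (curvature_operator G x u v v \<bullet> (G x *v u)) /
     ((u \<bullet> (G x *v u)) * (v \<bullet> (G x *v v)) - (u \<bullet> (G x *v v))\<^sup>2)"

text \<open>The usual Ricci tensor \<open>Ric(Y,Z) = tr(X \<mapsto> R(X,Y)Z)\<close>.\<close>

definition ricci ::
  "(real^'n \<Rightarrow> real^'n^'n) \<Rightarrow> real^'n \<Rightarrow> real^'n^'n::finite" where
  "ricci G x = (\<chi> j k. \<Sum>i\<in>UNIV. riemann G x i k i j)"


section \<open>Submanifolds of Euclidean space and metrics on them\<close>

definition local_parametrization ::
  "'a::euclidean_space set \<Rightarrow> (real^'n::finite) set \<Rightarrow> (real^'n \<Rightarrow> 'a) \<Rightarrow> bool" where
  "local_parametrization M U \<phi> \<longleftrightarrow>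
     open U \<and> smooth_on U \<phi> \<and>
     (\<forall>x\<in>U. inj (frechet_derivative \<phi> (at x))) \<and>
     openin (top_of_set M) (\<phi> ` U) \<and>
     (\<exists>\<psi>. homeomorphism U (\<phi> ` U) \<phi> \<psi>)"

text \<open>A metric on \<open>M\<close> takes a point of \<open>M\<close> and two tangent vectors, regarded as vectors of the
  ambient space; it is only ever evaluated on vectors \<open>\<partial>\<^sub>i\<phi>\<close>, which are tangent to \<open>M\<close>.\<close>

type_synonym 'a metric_field = "'a \<Rightarrow> 'a \<Rightarrow> 'a \<Rightarrow> real"

definition metric_coeffs ::
  "'a::euclidean_space metric_field \<Rightarrow> (real^'n::finite \<Rightarrow> 'a) \<Rightarrow> real^'n \<Rightarrow> real^'n^'n" where
  "metric_coeffs g \<phi> x =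
     (\<chi> i j. g (\<phi> x) (partial_derivative i \<phi> x) (partial_derivative j \<phi> x))"

text \<open>The first argument fixes the dimension \<open>CARD('n)\<close> of the submanifold \<open>M\<close>.\<close>

definition riemannian_metric_on ::
  "'n::finite itself \<Rightarrow> 'a::euclidean_space set \<Rightarrow> 'a metric_field \<Rightarrow> bool" where
  "riemannian_metric_on _ M g \<longleftrightarrow>
     (\<forall>(U :: (real^'n) set) \<phi>. local_parametrization M U \<phi> \<longrightarrow>
        smooth_on U (metric_coeffs g \<phi>) \<and>
        (\<forall>x\<in>U. transpose (metric_coeffs g \<phi> x) = metric_coeffs g \<phi> x \<and>
                (\<forall>v. v \<noteq> 0 \<longrightarrow> v \<bullet> (metric_coeffs g \<phi> x *v v) > 0)))"

definition has_constant_sectional_curvature ::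
  "'n::finite itself \<Rightarrow> 'a::euclidean_space set \<Rightarrow> 'a metric_field \<Rightarrow> real \<Rightarrow> bool" where
  "has_constant_sectional_curvature n M g K \<longleftrightarrow>
     riemannian_metric_on n M g \<and>
     (\<forall>(U :: (real^'n) set) \<phi>. local_parametrization M U \<phi> \<longrightarrow>
        (\<forall>x\<in>U. \<forall>u v. u \<noteq> v \<and> independent {u, v} \<longrightarrow>
           sectional_curvature (metric_coeffs g \<phi>) x u v = K))"

text \<open>A covariant 2-tensor on \<open>M\<close> is given by its coefficient matrices in all local
  parametrizations. \<open>tensor_quotient M h g\<close> is the scalar \<open>c\<close> with \<open>h = c g\<close>; it is meaningful
  only if \<open>h\<close> is a constant multiple of \<open>g\<close>.\<close>

definition tensor_quotient ::
  "'a::euclidean_space set \<Rightarrow> ((real^'n::finite \<Rightarrow> 'a) \<Rightarrow> real^'n \<Rightarrow> real^'n^'n) \<Rightarrow>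
   ((real^'n \<Rightarrow> 'a) \<Rightarrow> real^'n \<Rightarrow> real^'n^'n) \<Rightarrow> real" where
  "tensor_quotient M h g =
     (THE c. \<forall>U \<phi>. local_parametrization M U \<phi> \<longrightarrow> (\<forall>x\<in>U. h \<phi> x = c *\<^sub>R g \<phi> x))"


section \<open>Round metrics on the 3-sphere\<close>

abbreviation S3 :: "(real^4) set" where
  "S3 \<equiv> sphere 0 1"

definition round_metric :: "(real^4) metric_field" where
  "round_metric p v w = v \<bullet> w"

definition round_family :: "(real \<Rightarrow> real) \<Rightarrow> real \<Rightarrow> (real^4) metric_field" where
  "round_family f t p v w = (f t)\<^sup>2 * round_metric p v w"

text \<open>\<open>(\<partial>\<^sub>t g\<^sub>t) / g\<^sub>t\<close> for a family of metrics \<open>g\<^sub>t\<close> on the 3-sphere.\<close>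

definition metric_rate :: "(real \<Rightarrow> (real^4) metric_field) \<Rightarrow> real \<Rightarrow> real" where
  "metric_rate g t =
     tensor_quotient S3
       (\<lambda>(\<phi> :: real^3 \<Rightarrow> real^4) x. \<chi> i j. deriv (\<lambda>s. metric_coeffs (g s) \<phi> x $ i $ j) t)
       (metric_coeffs (g t))"

text \<open>\<open>Ric / g\<close> for a metric \<open>g\<close> on the 3-sphere. The factor 2 is the normalization in which the
  curvature 2-form of an orthonormal coframe is \<open>\<Omega>\<^sup>i\<^sub>j = (1/2) R\<^sup>i\<^sub>j\<^sub>i\<^sub>j \<epsilon>\<^sup>i \<and> \<epsilon>\<^sup>j\<close> without summation,
  so that \<open>Ric\<close> is twice the usual Ricci tensor.\<close>

definition ricci_scalar :: "(real^4) metric_field \<Rightarrow> real" where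
  "ricci_scalar g =
     tensor_quotient S3
       (\<lambda>(\<phi> :: real^3 \<Rightarrow> real^4) x. 2 *\<^sub>R ricci (metric_coeffs g \<phi>) x)
       (metric_coeffs g)"

text \<open>The metric \<open>dt\<^sup>2 + g\<^sub>t\<close>.\<close>

definition space_time_metric ::
  "(real \<Rightarrow> (real^4) metric_field) \<Rightarrow> (real \<times> (real^4)) metric_field" where
  "space_time_metric g q a b =
     fst a * fst b + g (fst q) (snd q) (snd a) (snd b)"

end

theory Submission
  imports Defs
begin

text \<open>On the sphere the flow equation reads \<open>2 f' / f = sqrt (4 / f\<^sup>2 - 4 K)\<close>, that is \<open>f'\<^sup>2 = 1 - K f\<^sup>2\<close>
  with \<open>f' \<ge> 0\<close>. Differentiating gives \<open>f' (f'' + K f) = 0\<close>; the continuous function \<open>f'' + K f\<close> only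
  takes the values 0 and 1 (the latter where \<open>f' = 0\<close>) and is 0 near \<open>t = 0\<close>, so \<open>f'' = - K f\<close>
  throughout. These two equations say that \<open>(t, p) \<mapsto> (f' t, f t p)\<close> is an isometric immersion of the
  warped product into a quadric (or a hyperplane, for \<open>K = 0\<close>), whose curvature is \<open>K\<close> by the Gauss
  equation. The same equation computes the Ricci tensor of the round 3-sphere.\<close>

section \<open>Calculus of smooth functions\<close>

text \<open>Hypotheses (through \<open>ricci_scalar\<close> and \<open>metric_rate\<close>) and
  conclusion quantify over all local parametrizations, so no adapted coordinates can be chosen. The
  extrinsic route works in an arbitrary chart: \<open>christoffel\<close> and \<open>riemann\<close>
  are expressed by derivatives of the immersion, and one locale serves both the 3-sphere and the
  warped product. The immersion is isometric because the image of the unit time vector has square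
  length \<open>K * f''^2 + f'^2\<close>, which \<open>f'' = - K f\<close> and
  \<open>K^3 = K\<close> turn into \<open>K * f^2 + f'^2 = 1\<close>. The obstacle is that for
  \<open>K = 1\<close> the first-order equation does not determine \<open>f\<close>: the sine up to
  pi/2, continued by the constant 1, also satisfies it. That function is only once continuously
  differentiable; on its constant stretch \<open>f'' + K f\<close> is 1. This is why the
  second-order equation needs continuity of \<open>f''\<close> and a connectedness argument instead
  of division by \<open>f'\<close>.\<close>

lemma differentiable_cong:
  assumes "open S" "x \<in> S" "\<And>y. y \<in> S \<Longrightarrow> h y = h' y" "h differentiable (at x)"
  shows "h' differentiable (at x)"
proof -
  obtain D where "(h has_derivative D) (at x)" using assms(4) by (auto simp: differentiable_def)
  from has_derivative_transform_within_open[OF this assms(1,2,3)] show ?thesis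
    by (auto simp: differentiable_def)
qed

lemma continuously_differentiable_on_cong:
  assumes "open S" "\<And>x. x \<in> S \<Longrightarrow> h x = h' x" "continuously_differentiable_on k S h"
  shows "continuously_differentiable_on k S h'"
  using assms(2,3)
proof (induction k arbitrary: h h')
  case 0
  then show ?case by (metis continuous_on_cong continuously_differentiable_on.simps(1))
next
  case (Suc k)
  have d: "h differentiable (at x)" if "x \<in> S" for x using Suc.prems that by simp
  have e: "frechet_derivative h (at x) = frechet_derivative h' (at x)" if "x \<in> S" for x
    using frechet_derivative_transform_within_open[OF d[OF that] assms(1) that] Suc.prems(1) by metis
  have d': "h' differentiable (at x)" if "x \<in> S" for x
    using Suc.prems(1) d[OF that] by (rule differentiable_cong[OF assms(1) that])
  have "continuously_differentiable_on k S (\<lambda>x. frechet_derivative h' (at x) v)" for v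
    by (rule Suc.IH[of "\<lambda>x. frechet_derivative h (at x) v"]) (use Suc.prems(2) e in auto)
  then show ?case using d' by simp
qed

text \<open>Lets a smoothness induction run on the formula produced by a calculus rule instead of on
  \<open>frechet_derivative\<close>, with which it is known to agree only on
  \<open>S\<close>.\<close>

lemma continuously_differentiable_on_SucI:
  assumes "open S" "\<And>x. x \<in> S \<Longrightarrow> (h has_derivative h' x) (at x)"
    "\<And>v. continuously_differentiable_on k S (\<lambda>x. h' x v)"
  shows "continuously_differentiable_on (Suc k) S h"
proof -
  have "continuously_differentiable_on k S (\<lambda>x. frechet_derivative h (at x) v)" for v
    by (rule continuously_differentiable_on_cong[OF assms(1) _ assms(3)[of v]])
       (metis assms(2) frechet_derivative_at)
  then show ?thesis using assms(2) by (auto simp: differentiable_def)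
qed

lemma continuously_differentiable_on_add:
  assumes "open S" "continuously_differentiable_on k S f" "continuously_differentiable_on k S g"
  shows "continuously_differentiable_on k S (\<lambda>x. f x + g x)"
  using assms(2,3)
proof (induction k arbitrary: f g)
  case 0
  then show ?case by (auto intro: continuous_intros)
next
  case (Suc k)
  show ?case
    by (rule continuously_differentiable_on_SucI[OF assms(1)])
       (use Suc in \<open>auto intro!: has_derivative_add simp: frechet_derivative_works\<close>)
qed

lemma smooth_on_continuous: "smooth_on S h \<Longrightarrow> continuous_on S h"
  unfolding smooth_on_def by (metis continuously_differentiable_on.simps(1))

lemma smooth_on_has_derivative:
  "smooth_on S h \<Longrightarrow> x \<in> S \<Longrightarrow> (h has_derivative frechet_derivative h (at x)) (at x)"
  unfolding smooth_on_def frechet_derivative_works[symmetric]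
  by (metis continuously_differentiable_on.simps(2))

lemma smooth_on_frechet_derivative:
  "smooth_on S h \<Longrightarrow> smooth_on S (\<lambda>x. frechet_derivative h (at x) v)"
  unfolding smooth_on_def by (metis continuously_differentiable_on.simps(2))

lemma smooth_on_cong:
  "open S \<Longrightarrow> (\<And>x. x \<in> S \<Longrightarrow> h x = h' x) \<Longrightarrow> smooth_on S h \<Longrightarrow> smooth_on S h'"
  unfolding smooth_on_def using continuously_differentiable_on_cong by metis

lemma smooth_on_add:
  "open S \<Longrightarrow> smooth_on S f \<Longrightarrow> smooth_on S g \<Longrightarrow> smooth_on S (\<lambda>x. f x + g x)"
  unfolding smooth_on_def using continuously_differentiable_on_add by blast

lemma smooth_on_const:
  assumes "open S" shows "smooth_on S (\<lambda>x. c)"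
proof -
  have "continuously_differentiable_on k S (\<lambda>x. c)" for k
  proof (induction k arbitrary: c)
    case (Suc k)
    show ?case
      by (rule continuously_differentiable_on_SucI[OF assms has_derivative_const Suc])
  qed simp
  then show ?thesis by (simp add: smooth_on_def)
qed

lemma smooth_on_sum:
  assumes "open S" "\<And>i. i \<in> I \<Longrightarrow> smooth_on S (f i)"
  shows "smooth_on S (\<lambda>x. \<Sum>i\<in>I. f i x)"
  using assms(2)
  by (induction I rule: infinite_finite_induct) (auto intro: smooth_on_add smooth_on_const assms(1))

lemma smooth_on_bounded_linear:
  assumes "open S" "bounded_linear L" "smooth_on S f"
  shows "smooth_on S (\<lambda>x. L (f x))"
proof -
  have "continuously_differentiable_on k S (\<lambda>x. L (f x))" if "smooth_on S f" for k f
    using that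
  proof (induction k arbitrary: f)
    case 0
    then show ?case
      by (simp add: assms(2) bounded_linear.continuous_on smooth_on_continuous)
  next
    case (Suc k)
    show ?case
      by (rule continuously_differentiable_on_SucI[OF assms(1)
            bounded_linear.has_derivative[OF assms(2) smooth_on_has_derivative[OF Suc.prems]]
            Suc.IH[OF smooth_on_frechet_derivative[OF Suc.prems]]])
  qed
  then show ?thesis using assms(3) by (simp add: smooth_on_def)
qed

lemma smooth_on_bilinear:
  assumes "open S" "bounded_bilinear B" "smooth_on S f" "smooth_on S g"
  shows "smooth_on S (\<lambda>x. B (f x) (g x))"
proof -
  \<comment> \<open>Claimed for all smooth pairs at once: the product rule yields two terms of the
    same shape, one order lower.\<close>
  have "continuously_differentiable_on k S (\<lambda>x. B (f x) (g x))" if "smooth_on S f" "smooth_on S g" for k f g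
    using that
  proof (induction k arbitrary: f g)
    case 0
    then show ?case
      by (simp add: bounded_bilinear.continuous_on[OF assms(2)] smooth_on_continuous)
  next
    case (Suc k)
    show ?case
      by (rule continuously_differentiable_on_SucI[OF assms(1)
            bounded_bilinear.FDERIV[OF assms(2) smooth_on_has_derivative[OF Suc.prems(1)]
              smooth_on_has_derivative[OF Suc.prems(2)]]])
        (auto intro!: continuously_differentiable_on_add assms(1) Suc smooth_on_frechet_derivative)
  qed
  then show ?thesis using assms(3,4) by (simp add: smooth_on_def)
qed

lemmas smooth_on_mult = smooth_on_bilinear[OF _ bounded_bilinear_mult]
lemmas smooth_on_scaleR = smooth_on_bilinear[OF _ bounded_bilinear_scaleR]
lemmas smooth_on_inner = smooth_on_bilinear[OF _ bounded_bilinear_inner]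

lemma smooth_on_compose_real:
  fixes h :: "'a::real_normed_vector \<Rightarrow> real"
  assumes "open S" "smooth_on S h"
    "\<And>n x. x \<in> S \<Longrightarrow> (D n has_real_derivative D (Suc n) (h x)) (at (h x))"
  shows "smooth_on S (\<lambda>x. D n (h x))"
proof -
  have *: "((\<lambda>x. D n (h x)) has_derivative (\<lambda>v. D (Suc n) (h x) * frechet_derivative h (at x) v)) (at x)"
    if "x \<in> S" for n x
    using has_derivative_compose[OF smooth_on_has_derivative[OF assms(2) that]
        assms(3)[OF that, of n, unfolded has_field_derivative_def]] by simp
  \<comment> \<open>The smooth factor \<open>q\<close> strengthens the induction: the chain rule
    passes from \<open>D n\<close> to \<open>D (Suc n)\<close> and leaves a derivative of
    \<open>h\<close> behind, which \<open>q\<close> absorbs. The goal is the case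
    \<open>q = 1\<close>.\<close>
  have "continuously_differentiable_on k S (\<lambda>x. D n (h x) * q x)" if "smooth_on S q" for k n q
    using that
  proof (induction k arbitrary: n q)
    case 0
    then show ?case
      using has_derivative_continuous[OF *, of _ n]
      by (simp add: continuous_on_mult smooth_on_continuous continuous_at_imp_continuous_on)
  next
    case (Suc k)
    have d: "((\<lambda>x. D n (h x) * q x) has_derivative (\<lambda>v. D n (h x) * frechet_derivative q (at x) v
         + D (Suc n) (h x) * (frechet_derivative h (at x) v * q x))) (at x)" if "x \<in> S" for x
      using has_derivative_mult[OF *[OF that, of n] smooth_on_has_derivative[OF Suc.prems that]]
      by (simp add: mult.assoc)
    show ?case
      by (rule continuously_differentiable_on_SucI[OF assms(1) d])
         (auto intro!: continuously_differentiable_on_add Suc.IH smooth_on_mult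
            smooth_on_frechet_derivative assms(1,2) Suc.prems)
  qed
  from this[OF smooth_on_const[OF assms(1), of 1]] show ?thesis by (simp add: smooth_on_def)
qed

lemma smooth_on_matrix:
  fixes h :: "'i::finite \<Rightarrow> 'j::finite \<Rightarrow> 'a::real_normed_vector \<Rightarrow> real"
  assumes "open S" "\<And>i j. smooth_on S (h i j)"
  shows "smooth_on S (\<lambda>x. \<chi> i j. h i j x)"
proof -
  have e: "(\<chi> i j. h i j x) = (\<Sum>i\<in>UNIV. \<Sum>j\<in>UNIV. h i j x *\<^sub>R axis i (axis j 1))" for x
  proof -
    have "(\<Sum>k\<in>UNIV. \<Sum>l\<in>UNIV. if i = k then if j = l then h k l x else 0 else 0)
        = (\<Sum>k\<in>UNIV. if i = k then h k j x else 0)" for i j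
      by (rule sum.cong) simp_all
    then show ?thesis
      by (simp add: vec_eq_iff axis_def if_distrib[of "\<lambda>z. z $ _"] if_distrib[of "\<lambda>z. _ * z"] cong: if_cong)
  qed
  show ?thesis unfolding e
    by (intro smooth_on_sum smooth_on_scaleR assms smooth_on_const)
qed

section \<open>Symmetry of second derivatives\<close>

lemma smooth_on_has_derivative_along:
  fixes h :: "'a::real_normed_vector \<Rightarrow> 'b::real_normed_vector"
  assumes "smooth_on S h" "x + r *\<^sub>R u \<in> S"
  shows "((\<lambda>r. h (x + r *\<^sub>R u)) has_vector_derivative frechet_derivative h (at (x + r *\<^sub>R u)) u) (at r)"
proof -
  have "((\<lambda>r. x + r *\<^sub>R u) has_vector_derivative u) (at r)"
    by (auto intro!: derivative_eq_intros)
  then have "((\<lambda>r. x + r *\<^sub>R u) has_derivative (\<lambda>r. r *\<^sub>R u)) (at r)"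
    by (simp add: has_vector_derivative_def)
  from has_derivative_compose[OF this smooth_on_has_derivative[OF assms]] show ?thesis
    unfolding has_vector_derivative_def
    using linear_cmul[OF has_derivative_linear[OF smooth_on_has_derivative[OF assms]]] by simp
qed

text \<open>The second difference \<open>\<Delta>\<^sub>u \<Delta>\<^sub>v h\<close> at step \<open>s\<close> is, by the mean value theorem applied
  twice, \<open>s\<^sup>2\<close> times a value of \<open>\<partial>\<^sub>v \<partial>\<^sub>u h\<close> at a nearby point.\<close>

lemma second_difference_mvt:
  fixes h :: "'a::real_normed_vector \<Rightarrow> real"
  assumes h: "smooth_on S h" and "0 < s"
    and S: "\<And>a b. 0 \<le> a \<Longrightarrow> a \<le> s \<Longrightarrow> 0 \<le> b \<Longrightarrow> b \<le> s \<Longrightarrow> x + a *\<^sub>R u + b *\<^sub>R v \<in> S"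
  obtains a b where "0 < a" "a < s" "0 < b" "b < s"
    "h (x + s *\<^sub>R u + s *\<^sub>R v) - h (x + s *\<^sub>R u) - (h (x + s *\<^sub>R v) - h x)
      = s * (s * frechet_derivative (\<lambda>y. frechet_derivative h (at y) u) (at (x + a *\<^sub>R u + b *\<^sub>R v)) v)"
proof -
  let ?hu = "\<lambda>y. frechet_derivative h (at y) u"
  let ?p = "\<lambda>r. h (x + s *\<^sub>R v + r *\<^sub>R u) - h (x + r *\<^sub>R u)"
  have S': "x + s *\<^sub>R v + r *\<^sub>R u \<in> S" "x + r *\<^sub>R u \<in> S" if "0 \<le> r" "r \<le> s" for r
    using S[of r s] S[of r 0] that \<open>0 < s\<close> by (simp_all add: algebra_simps)
  have "(?p has_real_derivative ?hu (x + s *\<^sub>R v + r *\<^sub>R u) - ?hu (x + r *\<^sub>R u)) (at r)"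
    if "0 \<le> r" "r \<le> s" for r
    unfolding has_real_derivative_iff_has_vector_derivative
    by (intro has_vector_derivative_diff smooth_on_has_derivative_along[OF h] S' that)
  from MVT2[OF \<open>0 < s\<close>, of ?p, OF this] obtain a where a: "0 < a" "a < s"
    "?p s - ?p 0 = (s - 0) * (?hu (x + s *\<^sub>R v + a *\<^sub>R u) - ?hu (x + a *\<^sub>R u))" by blast
  let ?q = "\<lambda>r. ?hu (x + a *\<^sub>R u + r *\<^sub>R v)"
  have "(?q has_real_derivative frechet_derivative ?hu (at (x + a *\<^sub>R u + r *\<^sub>R v)) v) (at r)"
    if "0 \<le> r" "r \<le> s" for r
    unfolding has_real_derivative_iff_has_vector_derivative
    by (intro smooth_on_has_derivative_along[OF smooth_on_frechet_derivative[OF h]] S that)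
       (use a in auto)
  from MVT2[OF \<open>0 < s\<close>, of ?q, OF this] obtain b where b: "0 < b" "b < s"
    "?q s - ?q 0 = (s - 0) * frechet_derivative ?hu (at (x + a *\<^sub>R u + b *\<^sub>R v)) v" by blast
  show ?thesis
    using that[OF a(1,2) b(1,2)] a(3) b(3) by (simp add: algebra_simps)
qed

text \<open>The second difference is symmetric in \<open>u\<close> and \<open>v\<close>, so on
  arbitrarily small parallelograms at \<open>x\<close> both mixed derivatives attain a common value.
  By continuity there is no gap between them at \<open>x\<close>.\<close>

lemma smooth_on_second_derivative_commute_real:
  fixes h :: "'a::real_normed_vector \<Rightarrow> real"
  assumes "open S" "smooth_on S h" "x \<in> S"
  shows "frechet_derivative (\<lambda>y. frechet_derivative h (at y) u) (at x) v
       = frechet_derivative (\<lambda>y. frechet_derivative h (at y) v) (at x) u"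
proof (rule ccontr)
  let ?f = "\<lambda>x. frechet_derivative (\<lambda>y. frechet_derivative h (at y) u) (at x) v"
  let ?g = "\<lambda>x. frechet_derivative (\<lambda>y. frechet_derivative h (at y) v) (at x) u"
  assume ne: "?f x \<noteq> ?g x"
  define e where "e = \<bar>?f x - ?g x\<bar> / 2"
  have "e > 0" using ne by (simp add: e_def)
  have c: "continuous (at x) (\<lambda>x. frechet_derivative (\<lambda>y. frechet_derivative h (at y) u) (at x) v)" for u v
  proof -
    have "continuous_on S (\<lambda>x. frechet_derivative (\<lambda>y. frechet_derivative h (at y) u) (at x) v)"
      by (intro smooth_on_continuous smooth_on_frechet_derivative assms(2))
    then show ?thesis using assms(1,3) continuous_on_eq_continuous_at by blast
  qed
  obtain d1 where d1: "d1 > 0" "\<And>y. dist y x < d1 \<Longrightarrow> dist (?f y) (?f x) < e"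
    using c[of u v] \<open>e > 0\<close> unfolding continuous_at_eps_delta by blast
  obtain d2 where d2: "d2 > 0" "\<And>y. dist y x < d2 \<Longrightarrow> dist (?g y) (?g x) < e"
    using c[of v u] \<open>e > 0\<close> unfolding continuous_at_eps_delta by blast
  obtain d3 where d3: "d3 > 0" "ball x d3 \<subseteq> S"
    using assms openE by blast
  define d where "d = min d1 (min d2 d3)"
  \<comment> \<open>Keeps the whole parallelogram within \<open>d / 2\<close> of \<open>x\<close>;
    the summand 1 makes the denominator positive even if both directions are zero.\<close>
  define s where "s = d / (2 * (norm u + norm v + 1))"
  have "d > 0" using d1 d2 d3 by (simp add: d_def)
  then have "s > 0" by (simp add: s_def add_nonneg_pos)
  have near: "dist (x + a *\<^sub>R u + b *\<^sub>R v) x < d" if "0 \<le> a" "a \<le> s" "0 \<le> b" "b \<le> s" for a b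
  proof -
    have "norm (a *\<^sub>R u + b *\<^sub>R v) \<le> s * norm u + s * norm v"
      by (rule order_trans[OF norm_triangle_ineq])
         (use that in \<open>auto intro!: add_mono mult_right_mono\<close>)
    also have "\<dots> \<le> s * (norm u + norm v + 1)" using \<open>s > 0\<close> by (simp add: algebra_simps)
    also have "\<dots> = d / 2"
      unfolding s_def using add_nonneg_pos[OF add_nonneg_nonneg[OF norm_ge_zero norm_ge_zero] zero_less_one, of u v]
      by (simp add: field_simps)
    also have "\<dots> < d" using \<open>d > 0\<close> by simp
    finally show ?thesis by (simp add: dist_norm algebra_simps)
  qed
  then have inS: "x + a *\<^sub>R u + b *\<^sub>R v \<in> S" if "0 \<le> a" "a \<le> s" "0 \<le> b" "b \<le> s" for a b
    using that d3 unfolding d_def by (force simp: dist_commute)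
  obtain a b where ab: "0 < a" "a < s" "0 < b" "b < s"
    "h (x + s *\<^sub>R u + s *\<^sub>R v) - h (x + s *\<^sub>R u) - (h (x + s *\<^sub>R v) - h x)
      = s * (s * ?f (x + a *\<^sub>R u + b *\<^sub>R v))"
    using second_difference_mvt[OF assms(2) \<open>s > 0\<close> inS] by blast
  obtain a' b' where ab': "0 < a'" "a' < s" "0 < b'" "b' < s"
    "h (x + s *\<^sub>R v + s *\<^sub>R u) - h (x + s *\<^sub>R v) - (h (x + s *\<^sub>R u) - h x)
      = s * (s * ?g (x + a' *\<^sub>R v + b' *\<^sub>R u))"
    by (rule second_difference_mvt[OF assms(2) \<open>s > 0\<close>, of x v u])
       (use inS in \<open>simp_all add: add.assoc add.commute[of "_ *\<^sub>R v"]\<close>)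
  have "s * (s * ?f (x + a *\<^sub>R u + b *\<^sub>R v)) = s * (s * ?g (x + b' *\<^sub>R u + a' *\<^sub>R v))"
    using ab(5) ab'(5) by (simp add: algebra_simps)
  then have "?f (x + a *\<^sub>R u + b *\<^sub>R v) = ?g (x + b' *\<^sub>R u + a' *\<^sub>R v)" using \<open>s > 0\<close> by simp
  moreover have "dist (?f (x + a *\<^sub>R u + b *\<^sub>R v)) (?f x) < e"
    by (rule d1(2)) (use near[of a b] ab in \<open>simp add: d_def\<close>)
  moreover have "dist (?g (x + b' *\<^sub>R u + a' *\<^sub>R v)) (?g x) < e"
    by (rule d2(2)) (use near[of b' a'] ab' in \<open>simp add: d_def\<close>)
  ultimately show False by (simp add: dist_real_def e_def abs_if split: if_splits)
qed

lemma frechet_derivative_bounded_linear: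
  assumes "bounded_linear L" "(h has_derivative h') (at x)"
  shows "frechet_derivative (\<lambda>y. L (h y)) (at x) v = L (h' v)"
  using frechet_derivative_at[OF bounded_linear.has_derivative[OF assms]] by metis

lemma smooth_on_second_derivative_commute:
  fixes h :: "'a::real_normed_vector \<Rightarrow> 'b::euclidean_space"
  assumes "open S" "smooth_on S h" "x \<in> S"
  shows "frechet_derivative (\<lambda>y. frechet_derivative h (at y) u) (at x) v
       = frechet_derivative (\<lambda>y. frechet_derivative h (at y) v) (at x) u"
proof (rule euclidean_eqI)
  fix b :: 'b assume "b \<in> Basis"
  let ?h = "\<lambda>y. h y \<bullet> b"
  note lin = bounded_linear_inner_left[of b]
  have s: "smooth_on S ?h" by (rule smooth_on_bounded_linear[OF assms(1) lin assms(2)])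
  have "frechet_derivative (\<lambda>y. frechet_derivative ?h (at y) u) (at x) v
      = frechet_derivative (\<lambda>y. frechet_derivative h (at y) u) (at x) v \<bullet> b" for u v
  proof -
    have "((\<lambda>y. frechet_derivative h (at y) u \<bullet> b) has_derivative
       (\<lambda>v. frechet_derivative (\<lambda>y. frechet_derivative h (at y) u) (at x) v \<bullet> b)) (at x)"
      by (intro bounded_linear.has_derivative[OF lin] smooth_on_has_derivative[OF _ assms(3)]
          smooth_on_frechet_derivative assms(2))
    then have "((\<lambda>y. frechet_derivative ?h (at y) u) has_derivative
       (\<lambda>v. frechet_derivative (\<lambda>y. frechet_derivative h (at y) u) (at x) v \<bullet> b)) (at x)"
      by (rule has_derivative_transform_within_open[OF _ assms(1,3)])
         (rule frechet_derivative_bounded_linear[OF lin smooth_on_has_derivative[OF assms(2)], symmetric])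
    from frechet_derivative_at[OF this] show ?thesis by metis
  qed
  then show "frechet_derivative (\<lambda>y. frechet_derivative h (at y) u) (at x) v \<bullet> b
       = frechet_derivative (\<lambda>y. frechet_derivative h (at y) v) (at x) u \<bullet> b"
    using smooth_on_second_derivative_commute_real[OF assms(1) s assms(3)] by metis
qed


section \<open>Curvature of umbilic hypersurfaces\<close>

lemma smooth_on_differentiable: "smooth_on S h \<Longrightarrow> x \<in> S \<Longrightarrow> h differentiable (at x)"
  using smooth_on_has_derivative differentiable_def by blast

lemma smooth_on_partial_derivative:
  "smooth_on S h \<Longrightarrow> smooth_on S (partial_derivative i h)"
  using smooth_on_frechet_derivative[of S h "axis i 1"] by (simp add: partial_derivative_def[abs_def])

lemma partial_derivative_eq:
  "(h has_derivative h') (at x) \<Longrightarrow> partial_derivative i h x = h' (axis i 1)"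
  unfolding partial_derivative_def using frechet_derivative_at by metis

lemma partial_derivative_cong:
  assumes "open S" "x \<in> S" "\<And>y. y \<in> S \<Longrightarrow> h y = h' y" "h differentiable (at x)"
  shows "partial_derivative i h x = partial_derivative i h' x"
  unfolding partial_derivative_def
  using frechet_derivative_transform_within_open[OF assms(4,1,2,3)] by metis

lemma partial_derivative_bilinear:
  assumes "bounded_bilinear B" "h differentiable (at x)" "g differentiable (at x)"
  shows "partial_derivative i (\<lambda>y. B (h y) (g y)) x
    = B (h x) (partial_derivative i g x) + B (partial_derivative i h x) (g x)"
  using partial_derivative_eq[OF bounded_bilinear.FDERIV[OF assms(1)
        assms(2,3)[unfolded frechet_derivative_works]]]
  by (simp add: partial_derivative_def)

lemma partial_derivative_bounded_linear:
  assumes "bounded_linear L" "h differentiable (at x)"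
  shows "partial_derivative i (\<lambda>y. L (h y)) x = L (partial_derivative i h x)"
  using frechet_derivative_bounded_linear[OF assms(1) assms(2)[unfolded frechet_derivative_works]]
  by (simp add: partial_derivative_def)

lemma partial_derivative_diff:
  assumes "h differentiable (at x)" "g differentiable (at x)"
  shows "partial_derivative i (\<lambda>y. h y - g y) x = partial_derivative i h x - partial_derivative i g x"
  using partial_derivative_eq[OF has_derivative_diff[OF assms[unfolded frechet_derivative_works]]]
  by (simp add: partial_derivative_def)

lemma partial_derivative_sum:
  assumes "finite I" "\<And>k. k \<in> I \<Longrightarrow> h k differentiable (at x)"
  shows "partial_derivative i (\<lambda>y. \<Sum>k\<in>I. h k y) x = (\<Sum>k\<in>I. partial_derivative i (h k) x)"
  using partial_derivative_eq[OF has_derivative_sum[of I h "\<lambda>k. frechet_derivative (h k) (at x)" "at x"]]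
    assms(2)[unfolded frechet_derivative_works]
  by (simp add: partial_derivative_def)

lemma partial_derivative_commute:
  fixes h :: "real^'n::finite \<Rightarrow> 'b::euclidean_space"
  assumes "open S" "smooth_on S h" "x \<in> S"
  shows "partial_derivative i (partial_derivative j h) x = partial_derivative j (partial_derivative i h) x"
  using smooth_on_second_derivative_commute[OF assms]
  by (simp add: partial_derivative_def[abs_def])

section \<open>Differentiability of the inverse matrix\<close>

lemma differentiable_prod:
  fixes f :: "'i \<Rightarrow> 'a::real_normed_vector \<Rightarrow> real"
  assumes "\<And>i. i \<in> I \<Longrightarrow> f i differentiable (at x)"
  shows "(\<lambda>y. \<Prod>i\<in>I. f i y) differentiable (at x)"
  using assms by (induction I rule: infinite_finite_induct) auto

lemma differentiable_det:
  fixes A :: "'a::real_normed_vector \<Rightarrow> real^'n^'n::finite"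
  assumes "\<And>i j. (\<lambda>y. A y $ i $ j) differentiable (at x)"
  shows "(\<lambda>y. det (A y)) differentiable (at x)"
  unfolding det_def
  by (intro differentiable_sum ballI differentiable_mult differentiable_const differentiable_prod assms)
     (simp add: finite_permutations)

lemma matrix_inv_mult:
  fixes A :: "real^'n^'n::finite"
  assumes "invertible A"
  shows "A ** matrix_inv A = mat 1" "matrix_inv A ** A = mat 1"
  using someI_ex[OF assms[unfolded invertible_def]] by (simp_all add: matrix_inv_def)

text \<open>\<open>matrix_inv\<close> is defined by choice; as quotients of determinants its entries
  are visibly differentiable, which is needed because \<open>riemann\<close> differentiates
  \<open>christoffel\<close>.\<close>

lemma matrix_inv_cramer:
  fixes A :: "real^'n^'n::finite"
  assumes "invertible A"
  shows "matrix_inv A $ k $ l = det (\<chi> i j. if j = k then axis l 1 $ i else A $ i $ j) / det A"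
proof -
  have "A ** matrix_inv A = mat 1" using assms by (rule matrix_inv_mult(1))
  then have "A *v (matrix_inv A *v axis l 1) = axis l 1"
    by (simp add: matrix_vector_mul_assoc)
  then have "matrix_inv A *v axis l 1 = (\<chi> k. det (\<chi> i j. if j = k then axis l 1 $ i else A $ i $ j) / det A)"
    using cramer invertible_det_nz assms by blast
  moreover have "(matrix_inv A *v axis l 1) $ k = matrix_inv A $ k $ l"
    by (simp add: matrix_vector_mult_basis column_def)
  ultimately show ?thesis by simp
qed

lemma differentiable_matrix_inv:
  fixes A :: "'a::real_normed_vector \<Rightarrow> real^'n^'n::finite"
  assumes "open S" "x \<in> S" "\<And>y. y \<in> S \<Longrightarrow> invertible (A y)"
    and "\<And>i j. (\<lambda>y. A y $ i $ j) differentiable (at x)"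
  shows "(\<lambda>y. matrix_inv (A y) $ k $ l) differentiable (at x)"
proof -
  have "(\<lambda>y. (if j = k then axis l 1 $ i else A y $ i $ j)) differentiable (at x)" for i j
    by (cases "j = k") (simp_all add: assms(4))
  then have "(\<lambda>y. det (\<chi> i j. if j = k then axis l 1 $ i else A y $ i $ j) / det (A y)) differentiable (at x)"
    using assms(2,3,4) by (intro differentiable_divide differentiable_det) (auto simp: invertible_det_nz)
  then show ?thesis
    by (rule differentiable_cong[OF assms(1,2), rotated]) (rule matrix_inv_cramer[OF assms(3), symmetric])
qed

text \<open>An immersion \<open>F\<close> into a vector space with symmetric form \<open>B\<close>, inducing the metric \<open>G\<close>, whose
  normal direction is the position vector; \<open>B\<close> may be indefinite or degenerate, so that the sphere,
  Euclidean space and hyperbolic space (as a hyperboloid) are treated alike.\<close>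

locale umbilic_immersion =
  fixes U :: "(real^'n::finite) set" and F :: "real^'n \<Rightarrow> 'v::euclidean_space"
    and B :: "'v \<Rightarrow> 'v \<Rightarrow> real" and G :: "real^'n \<Rightarrow> real^'n^'n" and \<kappa> :: real
  assumes open_U: "open U" and smooth_F: "smooth_on U F"
    and bilinear_B: "bounded_bilinear B" and B_commute: "\<And>v w. B v w = B w v"
    and G_eq: "\<And>x i j. x \<in> U \<Longrightarrow> G x $ i $ j = B (partial_derivative i F x) (partial_derivative j F x)"
    and G_pos: "\<And>x v. x \<in> U \<Longrightarrow> v \<noteq> 0 \<Longrightarrow> v \<bullet> (G x *v v) > 0"
    and B_position: "\<And>x. x \<in> U \<Longrightarrow> \<kappa> = 0 \<or> \<kappa> * B (F x) (F x) = 1"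
    and B_radical: "\<And>x v w. x \<in> U \<Longrightarrow> (\<And>i. B v (partial_derivative i F x) = 0)
           \<Longrightarrow> \<kappa> * B v (F x) = 0 \<Longrightarrow> B v w = 0"
begin

interpretation B: bounded_bilinear B by (rule bilinear_B)

abbreviation "D i \<equiv> partial_derivative i F"
abbreviation "H i j \<equiv> partial_derivative i (D j)"

lemma smooth_D: "smooth_on U (D i)" and smooth_H: "smooth_on U (H i j)"
  by (intro smooth_on_partial_derivative smooth_F)+

lemmas diff_F = smooth_on_differentiable[OF smooth_F]
lemmas diff_D = smooth_on_differentiable[OF smooth_D]
lemmas diff_H = smooth_on_differentiable[OF smooth_H]

lemma H_commute: "x \<in> U \<Longrightarrow> H i j x = H j i x"
  by (rule partial_derivative_commute[OF open_U smooth_F])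

lemma G_commute: "x \<in> U \<Longrightarrow> G x $ i $ j = G x $ j $ i"
  by (simp add: G_eq B_commute)

lemma smooth_G: "smooth_on U (\<lambda>x. G x $ i $ j)"
  by (rule smooth_on_cong[OF open_U G_eq[symmetric]])
     (auto intro: smooth_on_bilinear[OF open_U bilinear_B] smooth_D)

lemma invertible_G: "x \<in> U \<Longrightarrow> invertible (G x)"
  using G_pos[of x] by (force simp: invertible_left_inverse matrix_left_invertible_ker)

lemma partial_derivative_G:
  assumes "x \<in> U"
  shows "partial_derivative m (\<lambda>y. G y $ i $ j) x = B (D i x) (H m j x) + B (H m i x) (D j x)"
  using partial_derivative_cong[OF open_U assms G_eq smooth_on_differentiable[OF smooth_G assms]]
    partial_derivative_bilinear[OF bilinear_B diff_D[OF assms] diff_D[OF assms]] by simp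

text \<open>The product rule expands the three derivatives of \<open>G\<close> into six terms;
  symmetry of \<open>H\<close> cancels four of them and makes the other two equal.\<close>

lemma christoffel_eq:
  assumes "x \<in> U"
  shows "christoffel G x k i j = (\<Sum>l\<in>UNIV. matrix_inv (G x) $ k $ l * B (H i j x) (D l x))"
proof -
  have "partial_derivative i (\<lambda>y. G y $ j $ l) x + partial_derivative j (\<lambda>y. G y $ i $ l) x
         - partial_derivative l (\<lambda>y. G y $ i $ j) x = 2 * B (H i j x) (D l x)" for l
    using H_commute[OF assms, of i l] H_commute[OF assms, of j l] H_commute[OF assms, of i j]
    by (simp add: partial_derivative_G[OF assms] B_commute)
  then show ?thesis by (simp add: christoffel_def sum_distrib_left mult.left_commute)
qed

text \<open>Identifies the Christoffel symbols as the coefficients of the tangential part of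
  \<open>H i j\<close>: both have the same products with every \<open>D l x\<close>.\<close>

lemma christoffel_lower:
  assumes "x \<in> U"
  shows "(\<Sum>k\<in>UNIV. christoffel G x k i j * G x $ k $ l) = B (H i j x) (D l x)"
proof -
  have "(\<Sum>k\<in>UNIV. matrix_inv (G x) $ k $ m * G x $ k $ l) = (if l = m then 1 else 0)" for m
  proof -
    have "(G x ** matrix_inv (G x)) $ l $ m = (if l = m then 1 else 0)"
      by (simp add: matrix_inv_mult(1)[OF invertible_G[OF assms]] mat_def)
    then show ?thesis
      by (simp only: matrix_matrix_mult_def vec_lambda_beta G_commute[OF assms, of _ l] mult.commute)
  qed
  moreover have "(\<Sum>k\<in>UNIV. christoffel G x k i j * G x $ k $ l)
      = (\<Sum>m\<in>UNIV. B (H i j x) (D m x) * (\<Sum>k\<in>UNIV. matrix_inv (G x) $ k $ m * G x $ k $ l))"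
    unfolding christoffel_eq[OF assms] sum_distrib_left sum_distrib_right
    by (subst sum.swap) (simp add: mult_ac)
  ultimately show ?thesis by (simp add: if_distrib[of "\<lambda>z. _ * z"] cong: if_cong)
qed

lemma differentiable_christoffel:
  assumes "x \<in> U"
  shows "(\<lambda>y. christoffel G y k i j) differentiable (at x)"
proof -
  have "(\<lambda>y. \<Sum>l\<in>UNIV. matrix_inv (G y) $ k $ l * B (H i j y) (D l y)) differentiable (at x)"
    by (intro differentiable_sum ballI differentiable_mult
        differentiable_matrix_inv[OF open_U assms invertible_G]
        smooth_on_differentiable[OF smooth_G assms]
        smooth_on_differentiable[OF smooth_on_bilinear[OF open_U bilinear_B smooth_H smooth_D] assms]) auto
  then show ?thesis
    by (rule differentiable_cong[OF open_U assms, rotated]) (rule christoffel_eq[symmetric])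
qed

text \<open>Differentiating the constant \<open>B (F x) (F x) = 1 / \<kappa>\<close> shows that the
  position vector is normal. The factor \<open>\<kappa>\<close> makes the relation void in the flat
  case.\<close>

lemma B_position_D:
  assumes "x \<in> U" shows "\<kappa> * B (F x) (D i x) = 0"
proof (cases "\<kappa> = 0")
  case False
  have "partial_derivative i (\<lambda>y. B (F y) (F y)) x = partial_derivative i (\<lambda>y. 1 / \<kappa>) x"
    by (rule partial_derivative_cong[OF open_U assms])
       (use B_position False in \<open>force simp: field_simps\<close>,
        rule smooth_on_differentiable[OF smooth_on_bilinear[OF open_U bilinear_B smooth_F smooth_F] assms])
  also have "\<dots> = 0" using partial_derivative_eq[OF has_derivative_const] .
  finally show ?thesis
    using partial_derivative_bilinear[OF bilinear_B diff_F[OF assms] diff_F[OF assms], of i]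
    by (simp add: B_commute)
qed simp

text \<open>Differentiating normality of the position vector once more: with respect to that normal,
  the second fundamental form is \<open>- G\<close>, which is umbilicity.\<close>

lemma B_position_H:
  assumes "x \<in> U" shows "\<kappa> * B (F x) (H i j x) = - \<kappa> * G x $ i $ j"
proof (cases "\<kappa> = 0")
  case False
  have "partial_derivative i (\<lambda>y. B (F y) (D j y)) x = partial_derivative i (\<lambda>y. 0) x"
    by (rule partial_derivative_cong[OF open_U assms])
       (use B_position_D False in force,
        rule smooth_on_differentiable[OF smooth_on_bilinear[OF open_U bilinear_B smooth_F smooth_D] assms])
  also have "\<dots> = 0" using partial_derivative_eq[OF has_derivative_const] .
  finally show ?thesis
    using partial_derivative_bilinear[OF bilinear_B diff_F[OF assms] diff_D[OF assms], of i]
    by (simp add: G_eq assms eq_neg_iff_add_eq_0 flip: distrib_left)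
qed simp

text \<open>The defect \<open>W\<close> is orthogonal to all tangent vectors by
  \<open>christoffel_lower\<close> and, unless \<open>\<kappa> = 0\<close>, to the position vector
  by umbilicity; \<open>B_radical\<close> then puts it into the radical of \<open>B\<close>. Since
  \<open>B\<close> may be degenerate, the decomposition of \<open>H i j x\<close> is stated only
  after pairing with a vector \<open>w\<close>.\<close>

lemma gauss_formula:
  assumes "x \<in> U"
  shows "B (H i j x) w = (\<Sum>k\<in>UNIV. christoffel G x k i j * B (D k x) w) - \<kappa> * G x $ i $ j * B (F x) w"
proof -
  define W where "W = H i j x - (\<Sum>k\<in>UNIV. christoffel G x k i j *\<^sub>R D k x) + (\<kappa> * G x $ i $ j) *\<^sub>R F x"
  have W: "B W w = B (H i j x) w - (\<Sum>k\<in>UNIV. christoffel G x k i j * B (D k x) w)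
        + \<kappa> * G x $ i $ j * B (F x) w" for w
    by (simp add: W_def B.add_left B.diff_left B.sum_left B.scaleR_left)
  have "B W (D l x) = 0" for l
    unfolding W using christoffel_lower[OF assms, of i j l] B_position_D[OF assms, of l]
    by (auto simp: G_eq[OF assms, symmetric])
  moreover have "\<kappa> * B W (F x) = 0"
  proof -
    have "\<kappa> * (\<Sum>k\<in>UNIV. christoffel G x k i j * B (D k x) (F x)) = 0"
      using B_position_D[OF assms]
      by (cases "\<kappa> = 0") (simp_all add: B_commute[of _ "F x"])
    moreover have "\<kappa> * B (H i j x) (F x) + \<kappa> * (\<kappa> * G x $ i $ j * B (F x) (F x)) = 0"
      using B_position_H[OF assms, of i j] B_position[OF assms] by (auto simp: B_commute)
    ultimately show ?thesis unfolding W by (simp add: algebra_simps)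
  qed
  ultimately have "B W w = 0" by (rule B_radical[OF assms])
  then show ?thesis unfolding W by simp
qed

text \<open>Differentiating the Gauss formula produces exactly the combination of derivatives and
  products of Christoffel symbols that occurs in \<open>riemann\<close>.\<close>

lemma gauss_formula_derivative:
  assumes "x \<in> U"
  shows "B (partial_derivative m (H i j) x) (D l x) =
     (\<Sum>k\<in>UNIV. (partial_derivative m (\<lambda>y. christoffel G y k i j) x
         + (\<Sum>p\<in>UNIV. christoffel G x k m p * christoffel G x p i j)) * G x $ k $ l)
     - \<kappa> * G x $ i $ j * G x $ m $ l"
proof -
  \<comment> \<open>The test vector is frozen at \<open>x\<close>, so only the first argument of
    \<open>B\<close> is differentiated; being tangent at \<open>x\<close>, it also kills the term in
    which \<open>G\<close> is differentiated.\<close>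
  let ?w = "D l x"
  let ?c = "\<lambda>k y. christoffel G y k i j"
  note lin = B.bounded_linear_left[of ?w]
  have dB: "(\<lambda>y. B (h y) ?w) differentiable (at x)" if "h differentiable (at x)" for h
    using bounded_linear.has_derivative[OF lin] that unfolding differentiable_def by blast
  note d = differentiable_christoffel[OF assms] dB[OF diff_D[OF assms]] dB[OF diff_F[OF assms]]
    smooth_on_differentiable[OF smooth_G assms]
  have "B (partial_derivative m (H i j) x) ?w = partial_derivative m (\<lambda>y. B (H i j y) ?w) x"
    by (rule partial_derivative_bounded_linear[OF lin diff_H[OF assms], symmetric])
  also have "\<dots> = partial_derivative m (\<lambda>y. (\<Sum>k\<in>UNIV. ?c k y * B (D k y) ?w)
       - \<kappa> * (G y $ i $ j * B (F y) ?w)) x"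
    by (rule partial_derivative_cong[OF open_U assms _ dB[OF diff_H[OF assms]]])
       (simp add: gauss_formula mult.assoc)
  also have "\<dots> = (\<Sum>k\<in>UNIV. ?c k x * B (H m k x) ?w + partial_derivative m (?c k) x * B (D k x) ?w)
     - \<kappa> * (G x $ i $ j * B (D m x) ?w + partial_derivative m (\<lambda>y. G y $ i $ j) x * B (F x) ?w)"
  proof -
    have "(\<lambda>y. \<Sum>k\<in>UNIV. ?c k y * B (D k y) ?w) differentiable (at x)"
      "(\<lambda>y. \<kappa> * (G y $ i $ j * B (F y) ?w)) differentiable (at x)"
      by (intro differentiable_sum ballI differentiable_mult differentiable_const d finite)+
    then show ?thesis
      by (simp only: partial_derivative_diff partial_derivative_sum[OF finite differentiable_mult[OF d(1,2)]]
          partial_derivative_bilinear[OF bounded_bilinear_mult d(1,2)]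
          partial_derivative_bounded_linear[OF bounded_linear_mult_right differentiable_mult[OF d(4,3)]]
          partial_derivative_bilinear[OF bounded_bilinear_mult d(4,3)]
          partial_derivative_bounded_linear[OF lin diff_D[OF assms]]
          partial_derivative_bounded_linear[OF lin diff_F[OF assms]])
  qed
  also have "\<dots> = (\<Sum>k\<in>UNIV. ?c k x * B (H m k x) ?w + partial_derivative m (?c k) x * G x $ k $ l)
     - \<kappa> * G x $ i $ j * G x $ m $ l"
    using B_position_D[OF assms, of l] by (auto simp: G_eq[OF assms] algebra_simps)
  also have "(\<Sum>k\<in>UNIV. ?c k x * B (H m k x) ?w + partial_derivative m (?c k) x * G x $ k $ l)
     = (\<Sum>k\<in>UNIV. (partial_derivative m (?c k) x
         + (\<Sum>p\<in>UNIV. christoffel G x k m p * ?c p x)) * G x $ k $ l)"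
  proof -
    have "(\<Sum>k\<in>UNIV. ?c k x * B (H m k x) ?w)
       = (\<Sum>k\<in>UNIV. (\<Sum>p\<in>UNIV. christoffel G x k m p * ?c p x) * G x $ k $ l)"
      unfolding christoffel_lower[OF assms, symmetric] sum_distrib_left sum_distrib_right
      by (subst sum.swap) (simp add: mult_ac)
    then show ?thesis by (simp add: sum.distrib distrib_right add.commute)
  qed
  finally show ?thesis .
qed

text \<open>The Gauss equation: antisymmetrizing \<open>gauss_formula_derivative\<close> in
  \<open>i\<close> and \<open>j\<close> cancels the third derivatives of \<open>F\<close> and leaves
  only the products of \<open>G\<close>.\<close>

lemma riemann_lower:
  assumes "x \<in> U"
  shows "(\<Sum>l\<in>UNIV. riemann G x l k i j * G x $ l $ m)
    = \<kappa> * (G x $ j $ k * G x $ i $ m - G x $ i $ k * G x $ j $ m)"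
proof -
  let ?a = "\<lambda>i j l. partial_derivative i (\<lambda>y. christoffel G y l j k) x
      + (\<Sum>p\<in>UNIV. christoffel G x l i p * christoffel G x p j k)"
  have a: "(\<Sum>l\<in>UNIV. ?a i j l * G x $ l $ m)
      = B (partial_derivative i (H j k) x) (D m x) + \<kappa> * G x $ j $ k * G x $ i $ m" for i j
    using gauss_formula_derivative[OF assms, of i j k m] by simp
  have "riemann G x l k i j = ?a i j l - ?a j i l" for l
    by (simp add: riemann_def sum_subtractf)
  then have "(\<Sum>l\<in>UNIV. riemann G x l k i j * G x $ l $ m)
      = (\<Sum>l\<in>UNIV. ?a i j l * G x $ l $ m) - (\<Sum>l\<in>UNIV. ?a j i l * G x $ l $ m)"
    by (simp only: left_diff_distrib sum_subtractf)
  also have "\<dots> = \<kappa> * G x $ j $ k * G x $ i $ m - \<kappa> * G x $ i $ k * G x $ j $ m"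
    unfolding a partial_derivative_commute[OF open_U smooth_D assms, of i j] by simp
  finally show ?thesis by (simp add: right_diff_distrib mult.assoc)
qed

text \<open>Raises the index in \<open>riemann_lower\<close>: read as vectors indexed by
  \<open>l\<close>, both sides have the same image under the injective map
  \<open>G x\<close>.\<close>

lemma riemann_eq:
  assumes "x \<in> U"
  shows "riemann G x l k i j = \<kappa> * ((if l = i then G x $ j $ k else 0) - (if l = j then G x $ i $ k else 0))"
proof -
  let ?v = "(\<chi> l. riemann G x l k i j) :: real^'n"
  let ?w = "(\<chi> l. \<kappa> * ((if l = i then G x $ j $ k else 0) - (if l = j then G x $ i $ k else 0))) :: real^'n"
  have w: "(G x *v ?w) $ m = \<kappa> * (G x $ j $ k * G x $ m $ i - G x $ i $ k * G x $ m $ j)" for m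
  proof -
    have "G x $ m $ l * (\<kappa> * ((if l = i then G x $ j $ k else 0) - (if l = j then G x $ i $ k else 0)))
        = (if l = i then \<kappa> * (G x $ j $ k * G x $ m $ i) else 0)
        - (if l = j then \<kappa> * (G x $ i $ k * G x $ m $ j) else 0)" for l
      by (auto simp: right_diff_distrib)
    then show ?thesis
      by (simp only: matrix_vector_mult_def vec_lambda_beta sum_subtractf sum.delta finite UNIV_I
          if_True) (simp add: right_diff_distrib)
  qed
  have v: "(G x *v ?v) $ m = (\<Sum>l\<in>UNIV. riemann G x l k i j * G x $ l $ m)" for m
    unfolding matrix_vector_mult_def vec_lambda_beta
    by (intro sum.cong refl) (simp only: G_commute[OF assms, of m] mult.commute)
  have "(G x *v ?v) $ m = (G x *v ?w) $ m" for m
    unfolding v w riemann_lower[OF assms] G_commute[OF assms, of i m] G_commute[OF assms, of j m] ..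
  then have "G x *v ?v = G x *v ?w" by (intro vec_eq_iff[THEN iffD2] allI)
  then have "?v = ?w" by (rule injD[OF inj_matrix_vector_mult[OF invertible_G[OF assms]]])
  then have "?v $ l = ?w $ l" by (rule arg_cong)
  then show ?thesis unfolding vec_lambda_beta .
qed

lemma ricci_eq:
  assumes "x \<in> U"
  shows "ricci G x = (\<kappa> * (real CARD('n) - 1)) *\<^sub>R G x"
proof -
  have "ricci G x $ j $ k = (\<kappa> * (real CARD('n) - 1)) * G x $ j $ k" for j k
  proof -
    have "riemann G x i k i j = \<kappa> * G x $ j $ k - (if i = j then \<kappa> * G x $ j $ k else 0)" for i
      unfolding riemann_eq[OF assms] by (simp add: right_diff_distrib)
    then have "(\<Sum>i\<in>UNIV. riemann G x i k i j) = of_nat CARD('n) * (\<kappa> * G x $ j $ k) - \<kappa> * G x $ j $ k"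
      by (simp only: sum_subtractf sum_constant sum.delta finite UNIV_I if_True)
    also have "\<dots> = (\<kappa> * (real CARD('n) - 1)) * G x $ j $ k" by algebra
    finally show ?thesis by (simp only: ricci_def vec_lambda_beta)
  qed
  then show ?thesis by (simp only: vec_eq_iff vector_scaleR_component real_scaleR_def) simp
qed

lemma sectional_curvature_eq:
  assumes "x \<in> U" "u \<noteq> v" "independent {u, v}"
  shows "sectional_curvature G x u v = \<kappa>"
proof -
  let ?q = "\<lambda>a b. a \<bullet> (G x *v b)"
  have q: "?q a b = (\<Sum>i\<in>UNIV. \<Sum>j\<in>UNIV. G x $ i $ j * a $ i * b $ j)" for a b
    by (simp add: inner_vec_def matrix_vector_mult_def sum_distrib_left mult_ac)
  have q_sym: "?q a b = ?q b a" for a b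
    unfolding q by (subst sum.swap) (simp add: G_commute[OF assms(1)] mult_ac)
  have c: "curvature_operator G x u v v $ l = \<kappa> * (?q v v * u $ l - ?q u v * v $ l)" for l
  proof -
    have "(\<Sum>i\<in>UNIV. \<Sum>j\<in>UNIV. riemann G x l k i j * u $ i * v $ j * v $ k)
      = \<kappa> * (u $ l * (\<Sum>j\<in>UNIV. G x $ j $ k * v $ j * v $ k) - v $ l * (\<Sum>i\<in>UNIV. G x $ i $ k * u $ i * v $ k))" for k
    proof -
      have "riemann G x l k i j * u $ i * v $ j * v $ k
        = (if l = i then \<kappa> * u $ l * (G x $ j $ k * v $ j * v $ k) else 0)
          - (if l = j then \<kappa> * v $ l * (G x $ i $ k * u $ i * v $ k) else 0)" for i j
        by (simp add: riemann_eq[OF assms(1)] left_diff_distrib right_diff_distrib)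
      then have "(\<Sum>j\<in>UNIV. riemann G x l k i j * u $ i * v $ j * v $ k)
        = (if l = i then \<kappa> * u $ l * (\<Sum>j\<in>UNIV. G x $ j $ k * v $ j * v $ k) else 0)
          - \<kappa> * v $ l * (G x $ i $ k * u $ i * v $ k)" for i
        by (cases "l = i") (simp_all only: if_True if_False sum_subtractf sum.delta' finite UNIV_I
            sum_distrib_left[symmetric] sum.neutral_const simp_thms)
      then have "(\<Sum>i\<in>UNIV. \<Sum>j\<in>UNIV. riemann G x l k i j * u $ i * v $ j * v $ k)
        = \<kappa> * u $ l * (\<Sum>j\<in>UNIV. G x $ j $ k * v $ j * v $ k)
          - \<kappa> * v $ l * (\<Sum>i\<in>UNIV. G x $ i $ k * u $ i * v $ k)"
        by (simp only: sum_subtractf sum.delta' finite UNIV_I if_True sum_distrib_left[symmetric])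
      then show ?thesis by (simp only: right_diff_distrib mult.assoc)
    qed
    then have "curvature_operator G x u v v $ l = \<kappa> * (u $ l * (\<Sum>k\<in>UNIV. \<Sum>j\<in>UNIV. G x $ j $ k * v $ j * v $ k)
        - v $ l * (\<Sum>k\<in>UNIV. \<Sum>i\<in>UNIV. G x $ i $ k * u $ i * v $ k))"
      by (simp only: curvature_operator_def vec_lambda_beta sum_distrib_left[symmetric] sum_subtractf)
    also have "(\<Sum>k\<in>UNIV. \<Sum>j\<in>UNIV. G x $ j $ k * v $ j * v $ k) = ?q v v"
      unfolding q by (rule sum.swap)
    also have "(\<Sum>k\<in>UNIV. \<Sum>i\<in>UNIV. G x $ i $ k * u $ i * v $ k) = ?q u v"
      unfolding q by (rule sum.swap)
    finally show ?thesis by (simp only: mult.commute)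
  qed
  have "curvature_operator G x u v v = \<kappa> *\<^sub>R (?q v v *\<^sub>R u - ?q u v *\<^sub>R v)"
    by (simp add: vec_eq_iff c)
  then have num: "curvature_operator G x u v v \<bullet> (G x *v u) = \<kappa> * (?q u u * ?q v v - (?q u v)\<^sup>2)"
    unfolding \<open>curvature_operator G x u v v = _\<close>
    by (simp add: inner_diff_left q_sym[of v u] power2_eq_square)
  have "v \<noteq> 0" using assms(3) dependent_zero by auto
  have u: "u \<notin> span {v}" using assms(2,3) by (simp add: independent_insert)
  \<comment> \<open>The part of \<open>u\<close> orthogonal to \<open>v\<close>, scaled to avoid
    division. Its square length is \<open>?q v v\<close> times the denominator of the sectional
    curvature, which is therefore positive.\<close>
  let ?w = "?q v v *\<^sub>R u - ?q u v *\<^sub>R v"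
  have "?q v v > 0" using G_pos[OF assms(1) \<open>v \<noteq> 0\<close>] .
  have "?w \<noteq> 0"
  proof
    assume "?w = 0"
    then have "(1 / ?q v v) *\<^sub>R (?q v v *\<^sub>R u) = (1 / ?q v v) *\<^sub>R (?q u v *\<^sub>R v)" by simp
    then have "u = (1 / ?q v v) *\<^sub>R (?q u v *\<^sub>R v)" using \<open>?q v v > 0\<close> by simp
    moreover have "(1 / ?q v v) *\<^sub>R (?q u v *\<^sub>R v) \<in> span {v}" by (intro span_scale span_base) simp
    ultimately show False using u by metis
  qed
  have "?w \<bullet> (G x *v ?w) = ?q v v * (?q v v * ?q u u - ?q u v * ?q u v)
      - ?q u v * (?q v v * ?q u v - ?q u v * ?q v v)"
    by (simp only: matrix_vector_mult_diff_distrib matrix_vector_mult_scaleR inner_diff_left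
        inner_diff_right inner_scaleR_left inner_scaleR_right q_sym[of v u])
  also have "\<dots> = ?q v v * (?q u u * ?q v v - (?q u v)\<^sup>2)"
    by (simp add: power2_eq_square mult.commute)
  finally have "?q v v * (?q u u * ?q v v - (?q u v)\<^sup>2) > 0"
    using G_pos[OF assms(1) \<open>?w \<noteq> 0\<close>] by simp
  then have "?q u u * ?q v v - (?q u v)\<^sup>2 > 0"
    using \<open>?q v v > 0\<close> by (simp add: zero_less_mult_iff)
  then show ?thesis unfolding sectional_curvature_def num by simp
qed

end

section \<open>Parametrized submanifolds\<close>

lemma smooth_on_id:
  assumes "open S" shows "smooth_on S (\<lambda>x. x)"
proof -
  have "continuously_differentiable_on k S (\<lambda>x. x)" for k
  proof (cases k)
    case (Suc m)
    have "continuously_differentiable_on m S (\<lambda>x. v)" for v :: 'a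
      using smooth_on_const[OF assms, of v] by (simp add: smooth_on_def)
    then show ?thesis unfolding Suc
      by (rule continuously_differentiable_on_SucI[OF assms has_derivative_ident])
  qed (simp add: continuous_on_id)
  then show ?thesis by (simp add: smooth_on_def)
qed

lemma smooth_on_Pair:
  assumes "open S" "smooth_on S f" "smooth_on S g"
  shows "smooth_on S (\<lambda>x. (f x, g x))"
proof -
  have "bounded_linear (\<lambda>a. (a, 0))" "bounded_linear (\<lambda>b. (0, b))"
    by (intro bounded_linear_Pair bounded_linear_ident bounded_linear_zero)+
  from smooth_on_add[OF assms(1) smooth_on_bounded_linear[OF assms(1) this(1) assms(2)]
      smooth_on_bounded_linear[OF assms(1) this(2) assms(3)]]
  show ?thesis by simp
qed

lemma smooth_on_sqrt:
  assumes "open S" "smooth_on S h" "\<And>x. x \<in> S \<Longrightarrow> h x > 0"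
  shows "smooth_on S (\<lambda>x. sqrt (h x))"
proof -
  \<comment> \<open>The n-th derivative of the square root on the positive reals.\<close>
  define D where "D n y = (\<Prod>k<n. 1/2 - real k) * y powr (1/2 - real n)" for n and y :: real
  have "(D n has_real_derivative D (Suc n) y) (at y)" if "y > 0" for n y
  proof -
    have e: "1/2 - real (Suc n) = 1/2 - real n - 1" by simp
    show ?thesis
      using DERIV_cmult[OF has_real_derivative_powr[OF that, of "1/2 - real n"], of "\<Prod>k<n. 1/2 - real k"]
      by (simp only: D_def[abs_def] prod.lessThan_Suc e mult.assoc)
  qed
  then have "smooth_on S (\<lambda>x. D 0 (h x))"
    using smooth_on_compose_real[of S h D 0, OF assms(1,2)] assms(3) by simp
  then show ?thesis
    by (rule smooth_on_cong[OF assms(1), rotated]) (use assms(3) in \<open>simp add: D_def powr_half_sqrt less_imp_le\<close>)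
qed

lemma frechet_derivative_eq_sum_partial:
  fixes h :: "real^'n::finite \<Rightarrow> 'b::real_normed_vector"
  assumes "h differentiable (at x)"
  shows "frechet_derivative h (at x) u = (\<Sum>i\<in>UNIV. u $ i *\<^sub>R partial_derivative i h x)"
proof -
  note lin = linear_frechet_derivative[OF assms]
  have "frechet_derivative h (at x) (\<Sum>i\<in>UNIV. u $ i *\<^sub>R axis i 1)
     = (\<Sum>i\<in>UNIV. u $ i *\<^sub>R frechet_derivative h (at x) (axis i 1))"
    by (simp add: linear_sum[OF lin] linear_cmul[OF lin])
  then show ?thesis
    using basis_expansion[of u] by (simp add: scalar_mult_eq_scaleR partial_derivative_def)
qed

text \<open>Reduces positivity of the coefficient matrix to positivity of the ambient form on the
  image of the injective derivative.\<close>

lemma metric_coeffs_quadratic: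
  assumes "bounded_bilinear (g (\<phi> x))" "\<phi> differentiable (at x)"
  shows "v \<bullet> (metric_coeffs g \<phi> x *v v)
     = g (\<phi> x) (frechet_derivative \<phi> (at x) v) (frechet_derivative \<phi> (at x) v)"
proof -
  interpret bounded_bilinear "g (\<phi> x)" by fact
  have "g (\<phi> x) (frechet_derivative \<phi> (at x) v) (frechet_derivative \<phi> (at x) v)
      = (\<Sum>j\<in>UNIV. \<Sum>i\<in>UNIV. v $ j * (v $ i * g (\<phi> x) (partial_derivative i \<phi> x) (partial_derivative j \<phi> x)))"
    by (simp only: frechet_derivative_eq_sum_partial[OF assms(2)] sum_left sum_right scaleR_left scaleR_right
        real_scaleR_def sum_distrib_left)
  also have "\<dots> = v \<bullet> (metric_coeffs g \<phi> x *v v)"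
    by (subst sum.swap)
       (simp add: metric_coeffs_def inner_vec_def matrix_vector_mult_def sum_distrib_left mult_ac)
  finally show ?thesis by simp
qed

lemma local_parametrizationD:
  assumes "local_parametrization M U \<phi>"
  shows "open U" "smooth_on U \<phi>" "x \<in> U \<Longrightarrow> inj (frechet_derivative \<phi> (at x))" "x \<in> U \<Longrightarrow> \<phi> x \<in> M"
  using assms openin_imp_subset unfolding local_parametrization_def by blast+

text \<open>A dimension count. It identifies the tangent spaces of the sphere and of the product
  with the full orthogonal complement of the radial direction, so that tangent vectors can be
  prescribed.\<close>

lemma range_eq_hyperplane:
  fixes L :: "real^'n::finite \<Rightarrow> 'v::euclidean_space"
  assumes "linear L" "inj L" "DIM('v) = CARD('n) + 1" "\<nu> \<noteq> 0" "\<And>u. \<nu> \<bullet> L u = 0"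
  shows "range L = {w. \<nu> \<bullet> w = 0}"
proof (rule subspace_dim_equal)
  show "subspace (range L)" by (simp add: assms(1) linear_subspace_image)
  show "subspace {w. \<nu> \<bullet> w = 0}" by (rule subspace_hyperplane)
  show "range L \<subseteq> {w. \<nu> \<bullet> w = 0}" using assms(5) by auto
  have "dim (range L) = CARD('n)"
    using dim_image_eq[OF assms(1), of UNIV] assms(2) by simp
  then show "dim {w. \<nu> \<bullet> w = 0} \<le> dim (range L)"
    using dim_hyperplane[OF assms(4)] assms(3) by simp
qed

lemma frechet_derivative_sphere:
  fixes p :: "'a::real_normed_vector \<Rightarrow> 'b::real_inner"
  assumes "open U" "x \<in> U" "(p has_derivative p') (at x)" "\<And>y. y \<in> U \<Longrightarrow> norm (p y) = 1"
  shows "p x \<bullet> p' u = 0"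
proof -
  have "((\<lambda>y. p y \<bullet> p y) has_derivative (\<lambda>u. p x \<bullet> p' u + p' u \<bullet> p x)) (at x)"
    using has_derivative_inner[OF assms(3,3)] .
  moreover have "((\<lambda>y. p y \<bullet> p y) has_derivative (\<lambda>u. 0)) (at x)"
    by (rule has_derivative_transform_within_open[OF has_derivative_const[of 1] assms(1,2)])
       (simp add: dot_square_norm assms(4))
  ultimately have "(\<lambda>u. p x \<bullet> p' u + p' u \<bullet> p x) = (\<lambda>u. 0)" by (rule has_derivative_unique)
  from fun_cong[OF this, of u] show ?thesis by (simp add: inner_commute)
qed

text \<open>The definite description needs uniqueness, which comes from one chart point where the
  metric is nonzero; without any chart every scalar would qualify.\<close>

lemma tensor_quotient_eq:
  assumes "local_parametrization M U \<phi>" "x \<in> U" "g \<phi> x \<noteq> 0"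
    and "\<And>U \<phi> x. local_parametrization M U \<phi> \<Longrightarrow> x \<in> U \<Longrightarrow> h \<phi> x = c *\<^sub>R g \<phi> x"
  shows "tensor_quotient M h g = c"
  unfolding tensor_quotient_def
proof (rule the_equality)
  show "\<forall>U \<phi>. local_parametrization M U \<phi> \<longrightarrow> (\<forall>x\<in>U. h \<phi> x = c *\<^sub>R g \<phi> x)"
    using assms(4) by blast
next
  fix d assume "\<forall>U \<phi>. local_parametrization M U \<phi> \<longrightarrow> (\<forall>x\<in>U. h \<phi> x = d *\<^sub>R g \<phi> x)"
  then have "h \<phi> x = d *\<^sub>R g \<phi> x" using assms(1,2) by blast
  then show "d = c" using assms(4)[OF assms(1,2)] assms(3) by simp
qed


section \<open>The round three-sphere\<close>

text \<open>Supplies the chart point that \<open>tensor_quotient_eq\<close> asks for. The chart is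
  the open hemisphere \<open>p $ 4 > 0\<close> as a graph over the unit ball; the linear projection
  \<open>P\<close> is its inverse.\<close>

lemma S3_local_parametrization_exists:
  "\<exists>(U :: (real^3) set) \<phi> x. local_parametrization S3 U \<phi> \<and> x \<in> U"
proof -
  define E :: "real^3 \<Rightarrow> real^4"
    where "E x = (\<chi> i. if i = 1 then x $ 1 else if i = 2 then x $ 2 else if i = 3 then x $ 3 else 0)" for x
  define P :: "real^4 \<Rightarrow> real^3"
    where "P p = (\<chi> i. if i = 1 then p $ 1 else if i = 2 then p $ 2 else p $ 3)" for p
  define \<phi> where "\<phi> x = E x + sqrt (1 - x \<bullet> x) *\<^sub>R axis 4 1" for x
  let ?U = "ball (0 :: real^3) 1"
  have lE: "bounded_linear E" and lP: "bounded_linear P"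
    unfolding linear_conv_bounded_linear[symmetric]
    by (auto intro!: linearI simp: E_def P_def vec_eq_iff)
  have \<phi>_nth: "\<phi> x $ 1 = x $ 1" "\<phi> x $ 2 = x $ 2" "\<phi> x $ 3 = x $ 3" "\<phi> x $ 4 = sqrt (1 - x \<bullet> x)" for x
    by (simp_all add: \<phi>_def E_def axis_def)
  have P\<phi>: "P (\<phi> x) = x" for x
    by (simp add: P_def \<phi>_nth vec_eq_iff forall_3)
  have \<phi>P: "\<phi> (P p) = p" if "norm p = 1" "p $ 4 > 0" for p
  proof -
    have "p \<bullet> p = 1" using that by (simp add: dot_square_norm)
    then have "1 - P p \<bullet> P p = (p $ 4)\<^sup>2"
      by (simp add: P_def inner_vec_def sum_3 sum_4 power2_eq_square)
    then show ?thesis using that(2)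
      by (simp add: vec_eq_iff forall_4 \<phi>_nth) (simp add: P_def)
  qed
  have U: "x \<bullet> x < 1" if "x \<in> ?U" for x
    using that by (simp add: dot_square_norm power_less_one_iff)
  have sm: "smooth_on ?U \<phi>"
  proof -
    have "smooth_on ?U (\<lambda>x. 1 + - (x \<bullet> x))"
      by (intro smooth_on_add smooth_on_const open_ball smooth_on_inner smooth_on_id
          smooth_on_bounded_linear[OF _ bounded_linear_minus[OF bounded_linear_ident]])
    then have "smooth_on ?U (\<lambda>x. sqrt (1 - x \<bullet> x))"
      using U by (intro smooth_on_sqrt) simp_all
    then show ?thesis unfolding \<phi>_def[abs_def]
      by (intro smooth_on_add open_ball smooth_on_scaleR smooth_on_const
          smooth_on_bounded_linear[OF _ lE] smooth_on_id)
  qed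
  have inj: "inj (frechet_derivative \<phi> (at x))" if "x \<in> ?U" for x
  proof (rule inj_on_inverseI)
    fix v
    \<comment> \<open>Differentiating \<open>P (\<phi> y) = y\<close> shows that \<open>P\<close> is
      also a left inverse of the derivative.\<close>
    have "((\<lambda>y. P (\<phi> y)) has_derivative (\<lambda>v. P (frechet_derivative \<phi> (at x) v))) (at x)"
      by (rule bounded_linear.has_derivative[OF lP smooth_on_has_derivative[OF sm that]])
    then have "(\<lambda>v. P (frechet_derivative \<phi> (at x) v)) = (\<lambda>v. v)"
      unfolding P\<phi> by (rule has_derivative_unique) (rule has_derivative_ident)
    then show "P (frechet_derivative \<phi> (at x) v) = v" by meson
  qed
  have norm\<phi>: "norm (\<phi> x) = 1" "\<phi> x $ 4 > 0" if "x \<in> ?U" for x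
  proof -
    have "\<phi> x \<bullet> \<phi> x = 1" using U[OF that]
      by (simp add: inner_vec_def sum_4 \<phi>_nth) (simp add: inner_vec_def sum_3)
    then show "norm (\<phi> x) = 1" by (simp add: norm_eq_1)
    show "\<phi> x $ 4 > 0" using U[OF that] by (simp add: \<phi>_nth)
  qed
  have img: "\<phi> ` ?U = S3 \<inter> {p. p $ 4 > 0}"
  proof (intro equalityI subsetI)
    fix p assume p: "p \<in> S3 \<inter> {p. p $ 4 > 0}"
    then have "p \<bullet> p = 1" by (simp add: dot_square_norm)
    then have "P p \<bullet> P p = 1 - (p $ 4)\<^sup>2"
      by (simp add: P_def inner_vec_def sum_3 sum_4 power2_eq_square)
    also have "\<dots> < 1" using p by simp
    finally have "P p \<in> ?U" by (simp add: norm_eq_sqrt_inner)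
    moreover have "p = \<phi> (P p)" using \<phi>P p by simp
    ultimately show "p \<in> \<phi> ` ?U" by blast
  qed (use norm\<phi> in auto)
  have "homeomorphism ?U (\<phi> ` ?U) \<phi> P"
    unfolding homeomorphism_def
    using smooth_on_continuous[OF sm] linear_continuous_on[OF lP] P\<phi> by (auto simp: image_image)
  moreover have "openin (top_of_set S3) (\<phi> ` ?U)"
    unfolding img by (intro openin_open_Int open_halfspace_component_gt_cart)
  ultimately have "local_parametrization S3 ?U \<phi>"
    unfolding local_parametrization_def using sm inj by blast
  moreover have "0 \<in> ?U" by simp
  ultimately show ?thesis by blast
qed

lemma bounded_bilinear_scaled_inner: "bounded_bilinear (\<lambda>v w :: 'a::euclidean_space. c * (v \<bullet> w))"
  unfolding bilinear_conv_bounded_bilinear[symmetric] bilinear_def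
  by (auto intro!: linearI simp: inner_add_left inner_add_right algebra_simps)

lemma round_family_eq: "round_family f t p v w = (f t)\<^sup>2 * (v \<bullet> w)"
  by (simp add: round_family_def round_metric_def)

lemma S3_parametrization:
  fixes \<phi> :: "real^3 \<Rightarrow> real^4"
  assumes "local_parametrization S3 U \<phi>" "x \<in> U"
  shows "norm (\<phi> x) = 1" "\<phi> x \<bullet> frechet_derivative \<phi> (at x) u = 0"
    "range (frechet_derivative \<phi> (at x)) = {w. \<phi> x \<bullet> w = 0}"
proof -
  note lp = local_parametrizationD[OF assms(1)]
  note d = smooth_on_has_derivative[OF lp(2) assms(2)]
  have n: "norm (\<phi> y) = 1" if "y \<in> U" for y using lp(4)[OF that] by simp
  then show "norm (\<phi> x) = 1" using assms(2) by blast
  have o: "\<phi> x \<bullet> frechet_derivative \<phi> (at x) u = 0" for u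
    by (rule frechet_derivative_sphere[OF lp(1) assms(2) d n])
  then show "\<phi> x \<bullet> frechet_derivative \<phi> (at x) u = 0" .
  show "range (frechet_derivative \<phi> (at x)) = {w. \<phi> x \<bullet> w = 0}"
    by (rule range_eq_hyperplane[OF has_derivative_linear[OF d] lp(3)[OF assms(2)] _ _ o])
       (use n[OF assms(2)] in auto)
qed

lemma round_family_pos:
  fixes \<phi> :: "real^3 \<Rightarrow> real^4"
  assumes "local_parametrization S3 U \<phi>" "x \<in> U" "f t > 0" "v \<noteq> 0"
  shows "v \<bullet> (metric_coeffs (round_family f t) \<phi> x *v v) > 0"
proof -
  note lp = local_parametrizationD[OF assms(1)]
  note d = smooth_on_has_derivative[OF lp(2) assms(2)]
  have "frechet_derivative \<phi> (at x) v \<noteq> 0"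
    using injD[OF lp(3)[OF assms(2)], of v 0] assms(4) linear_0[OF has_derivative_linear[OF d]] by auto
  moreover have "bounded_bilinear (round_family f t (\<phi> x))"
    unfolding round_family_eq[abs_def] by (rule bounded_bilinear_scaled_inner)
  ultimately show ?thesis
    using assms(3) metric_coeffs_quadratic[OF _ smooth_on_differentiable[OF lp(2) assms(2)]]
    by (simp add: round_family_eq)
qed

text \<open>The inclusion of the unit sphere is kept and the ambient form is scaled instead;
  \<open>1 / (f t)\<^sup>2\<close> is the value of \<open>\<kappa>\<close> that gives the position
  vector \<open>\<kappa> * B (F x) (F x) = 1\<close>.\<close>

lemma umbilic_immersion_S3:
  fixes \<phi> :: "real^3 \<Rightarrow> real^4"
  assumes "local_parametrization S3 U \<phi>" "f t > 0"
  shows "umbilic_immersion U \<phi> (\<lambda>v w. (f t)\<^sup>2 * (v \<bullet> w)) (metric_coeffs (round_family f t) \<phi>) (1 / (f t)\<^sup>2)"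
proof (rule umbilic_immersion.intro)
  note lp = local_parametrizationD[OF assms(1)]
  show "open U" "smooth_on U \<phi>" using lp by blast+
  show "bounded_bilinear (\<lambda>v w :: real^4. (f t)\<^sup>2 * (v \<bullet> w))" by (rule bounded_bilinear_scaled_inner)
  show "(f t)\<^sup>2 * (v \<bullet> w) = (f t)\<^sup>2 * (w \<bullet> v)" for v w :: "real^4" by (simp add: inner_commute)
  show "metric_coeffs (round_family f t) \<phi> x $ i $ j
      = (f t)\<^sup>2 * (partial_derivative i \<phi> x \<bullet> partial_derivative j \<phi> x)" for x i j
    by (simp add: metric_coeffs_def round_family_eq)
  fix x assume x: "x \<in> U"
  show "v \<bullet> (metric_coeffs (round_family f t) \<phi> x *v v) > 0" if "v \<noteq> 0" for v
    by (rule round_family_pos[of U \<phi> x f t, OF assms(1) x assms(2) that])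
  show "1 / (f t)\<^sup>2 = 0 \<or> 1 / (f t)\<^sup>2 * ((f t)\<^sup>2 * (\<phi> x \<bullet> \<phi> x)) = 1"
    using assms(2) S3_parametrization(1)[OF assms(1) x] by (simp add: dot_square_norm)
  fix v w :: "real^4"
  assume v: "\<And>i. (f t)\<^sup>2 * (v \<bullet> partial_derivative i \<phi> x) = 0" "1 / (f t)\<^sup>2 * ((f t)\<^sup>2 * (v \<bullet> \<phi> x)) = 0"
  \<comment> \<open>Orthogonal to the radius, \<open>v\<close> is tangent; orthogonal to all tangent
    vectors, it is orthogonal to itself.\<close>
  have "\<phi> x \<bullet> v = 0" using v(2) assms(2) by (simp add: inner_commute)
  then obtain u where u: "v = frechet_derivative \<phi> (at x) u"
    using S3_parametrization(3)[OF assms(1) x] by blast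
  have "v \<bullet> frechet_derivative \<phi> (at x) u = 0"
    using v(1) assms(2)
    by (simp add: frechet_derivative_eq_sum_partial[OF smooth_on_differentiable[OF lp(2) x]] inner_sum_right)
  then have "v = 0" using u by simp
  then show "(f t)\<^sup>2 * (v \<bullet> w) = 0" by simp
qed

text \<open>The 4 is the normalization factor 2 times \<open>3 - 1\<close>, the trace factor of
  \<open>ricci_eq\<close> in dimension 3.\<close>

lemma ricci_scalar_round_family:
  assumes "f t > 0"
  shows "ricci_scalar (round_family f t) = 4 / (f t)\<^sup>2"
proof -
  obtain U :: "(real^3) set" and \<phi> x where p: "local_parametrization S3 U \<phi>" "x \<in> U"
    using S3_local_parametrization_exists by blast
  show ?thesis
    unfolding ricci_scalar_def
  proof (rule tensor_quotient_eq[OF p])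
    show "metric_coeffs (round_family f t) \<phi> x \<noteq> 0"
      using round_family_pos[of U \<phi> x f t, OF p assms, of "axis 1 1"] by (auto simp: axis_eq_0_iff)
    fix U :: "(real^3) set" and \<phi> x assume q: "local_parametrization S3 U \<phi>" "x \<in> U"
    show "2 *\<^sub>R ricci (metric_coeffs (round_family f t) \<phi>) x = (4 / (f t)\<^sup>2) *\<^sub>R metric_coeffs (round_family f t) \<phi> x"
      unfolding umbilic_immersion.ricci_eq[OF umbilic_immersion_S3[of U \<phi> f t, OF q(1) assms] q(2)] by simp
  qed
qed

lemma metric_rate_round_family:
  assumes "f t > 0" "(f has_real_derivative f') (at t)"
  shows "metric_rate (round_family f) t = 2 * f' / f t"
proof -
  obtain U :: "(real^3) set" and \<phi> x where p: "local_parametrization S3 U \<phi>" "x \<in> U"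
    using S3_local_parametrization_exists by blast
  show ?thesis
    unfolding metric_rate_def
  proof (rule tensor_quotient_eq[OF p])
    show "metric_coeffs (round_family f t) \<phi> x \<noteq> 0"
      using round_family_pos[of U \<phi> x f t "axis 1 1"] p assms by (auto simp: axis_eq_0_iff)
    fix U :: "(real^3) set" and \<phi> :: "real^3 \<Rightarrow> real^4" and x
    have "((\<lambda>s. (f s)\<^sup>2 * c) has_real_derivative (2 * f' / f t) * ((f t)\<^sup>2 * c)) (at t)" for c
      using assms(1) by (auto intro!: derivative_eq_intros assms(2) simp: power2_eq_square)
    then show "(\<chi> i j. deriv (\<lambda>s. metric_coeffs (round_family f s) \<phi> x $ i $ j) t)
        = (2 * f' / f t) *\<^sub>R metric_coeffs (round_family f t) \<phi> x"
      by (simp add: vec_eq_iff metric_coeffs_def round_family_eq DERIV_imp_deriv)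
  qed
qed

section \<open>The flow\<close>

lemma time_interval_cases:
  fixes T :: ereal
  obtains "{t. 0 < t \<and> ereal t < T} = {}" | "{t. 0 < t \<and> ereal t < T} = {0<..}"
    | r where "{t. 0 < t \<and> ereal t < T} = {0<..<r}"
proof (cases T)
  case (real r)
  then have "{t. 0 < t \<and> ereal t < T} = {0<..<r}" by auto
  then show ?thesis using that(3) by blast
next
  case PInf
  then have "{t. 0 < t \<and> ereal t < T} = {0<..}" by auto
  then show ?thesis using that(2) by blast
next
  case MInf
  then have "{t. 0 < t \<and> ereal t < T} = {}" by simp
  then show ?thesis using that(1) by blast
qed

lemma open_time_interval: "open {t. 0 < t \<and> ereal t < T}"
  by (cases T rule: time_interval_cases) (simp_all only: open_empty open_greaterThan open_greaterThanLessThan)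

lemma connected_time_interval: "connected {t. 0 < t \<and> ereal t < T}"
  by (cases T rule: time_interval_cases) (simp_all only: connected_empty connected_Ioi connected_Ioo)

lemma warping_function_second_derivative:
  fixes K :: real and T :: ereal
  assumes "K \<in> {-1, 0, 1}" "0 < T"
    and f: "\<And>t. 0 < t \<Longrightarrow> ereal t < T \<Longrightarrow> (f has_real_derivative f1 t) (at t)"
    and f1: "\<And>t. 0 < t \<Longrightarrow> ereal t < T \<Longrightarrow> (f1 has_real_derivative f2 t) (at t)"
    and f2: "continuous_on {t. 0 < t \<and> ereal t < T} f2"
    and pos: "\<And>t. 0 < t \<Longrightarrow> ereal t < T \<Longrightarrow> f t > 0"
    and f1_eq: "\<And>t. 0 < t \<Longrightarrow> ereal t < T \<Longrightarrow> f1 t \<ge> 0 \<and> (f1 t)\<^sup>2 = 1 - K * (f t)\<^sup>2"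
    and cont: "continuous (at 0 within {t. 0 \<le> t \<and> ereal t < T}) f" and "f 0 = 0"
    and t: "0 < t" "ereal t < T"
  shows "f2 t = - K * f t"
proof -
  let ?J = "{t. 0 < t \<and> ereal t < T}"
  let ?q = "\<lambda>t. f2 t + K * f t"
  note J = open_time_interval[of T]
  have zero: "f1 t = 0 \<or> ?q t = 0" if "t \<in> ?J" for t
  proof -
    have "((\<lambda>t. (f1 t)\<^sup>2 + K * (f t)\<^sup>2) has_real_derivative 2 * f1 t * ?q t) (at t)"
      using DERIV_add[OF DERIV_power[OF f1, of t 2] DERIV_cmult[OF DERIV_power[OF f, of t 2], of K]] that
      by (simp add: algebra_simps)
    moreover have "((\<lambda>t. (f1 t)\<^sup>2 + K * (f t)\<^sup>2) has_real_derivative 0) (at t)"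
      by (rule has_field_derivative_transform_within_open[OF DERIV_const[of 1] J that]) (simp add: f1_eq)
    ultimately have "2 * f1 t * ?q t = 0" by (rule DERIV_unique)
    then show ?thesis by simp
  qed
  have one: "?q t = 1" if t: "t \<in> ?J" "f1 t = 0" for t
  proof -
    obtain e where e: "e > 0" "ball t e \<subseteq> ?J" using openE[OF J t(1)] by blast
    \<comment> \<open>As \<open>f1\<close> is nonnegative, a zero of \<open>f1\<close> is a local
      minimum of it.\<close>
    have "f2 t = 0"
    proof (rule DERIV_local_min[OF f1 \<open>e > 0\<close>])
      show "\<forall>y. \<bar>t - y\<bar> < e \<longrightarrow> f1 t \<le> f1 y"
      proof (intro allI impI)
        fix y assume "\<bar>t - y\<bar> < e"
        then have "y \<in> ?J" using e(2) by (auto simp: dist_real_def)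
        then show "f1 t \<le> f1 y" using f1_eq[of y] t(2) by simp
      qed
    qed (use t in simp_all)
    moreover have "K * (f t)\<^sup>2 = 1" using f1_eq[of t] t by simp
    then have "K = 1 \<and> f t = 1"
      using assms(1) pos[of t] t zero_le_power2[of "f t"]
      by (elim insertE emptyE) (simp_all add: power2_eq_1_iff)
    ultimately show ?thesis by simp
  qed
  have "continuous_on ?J ?q"
  proof -
    have "isCont f t" if "t \<in> ?J" for t using DERIV_isCont[OF f] that by simp
    then have "continuous_on ?J f" by (simp add: continuous_at_imp_continuous_on)
    then show ?thesis by (rule continuous_on_add[OF f2 continuous_on_mult[OF continuous_on_const]])
  qed
  moreover have "finite (?q ` ?J)"
  proof (rule finite_subset)
    show "?q ` ?J \<subseteq> {0, 1}" using zero one by blast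
  qed simp
  ultimately have "?q constant_on ?J"
    by (intro continuous_finite_range_constant connected_time_interval)
  then obtain c where c: "\<And>t. t \<in> ?J \<Longrightarrow> ?q t = c" unfolding constant_on_def by blast
  obtain d where d: "d > 0" "\<forall>t\<in>{t. 0 \<le> t \<and> ereal t < T}. dist t 0 < d \<longrightarrow> dist (f t) (f 0) < 1"
    using cont[unfolded continuous_within_eps_delta] zero_less_one by blast
  obtain r where r: "0 < ereal r" "ereal r < T" using ereal_dense2[OF \<open>0 < T\<close>] by blast
  \<comment> \<open>One time inside the interval and so close to 0 that \<open>f s < 1\<close>
    suffices: there \<open>(f1 s)\<^sup>2 \<ge> 1 - (f s)\<^sup>2 > 0\<close> for each admissible
    \<open>K\<close>, so the constant \<open>c\<close> must be 0.\<close>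
  define s where "s = min r (d / 2)"
  have s: "s \<in> ?J" "\<bar>s\<bar> < d"
  proof -
    have "ereal s \<le> ereal r" by (simp add: s_def)
    then have "ereal s < T" using r(2) by (rule le_less_trans)
    then show "s \<in> ?J" "\<bar>s\<bar> < d" using r(1) d(1) by (simp_all add: s_def)
  qed
  have "dist (f s) (f 0) < 1" using d(2)[rule_format, of s] s by simp
  then have "f s < 1" using \<open>f 0 = 0\<close> by (simp add: dist_real_def)
  then have "(f s)\<^sup>2 < 1" using pos[of s] s by (simp add: power_less_one_iff)
  moreover have "K * (f s)\<^sup>2 \<le> 1 * (f s)\<^sup>2"
    using assms(1) by (intro mult_right_mono) auto
  ultimately have "f1 s \<noteq> 0" using f1_eq[of s] s by auto
  then have "c = 0" using zero[OF s(1)] c[OF s(1)] by simp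
  then show ?thesis using c[of t] t by simp
qed


section \<open>Warped products over the sphere\<close>

lemma space_time_metric_round_family:
  "space_time_metric (round_family f) q a b = fst a * fst b + (f (fst q))\<^sup>2 * (snd a \<bullet> snd b)"
  by (simp add: space_time_metric_def round_family_eq)

text \<open>The warped product embeds isometrically as \<open>(t, p) \<mapsto> (f' t, f t p)\<close> into \<open>\<real> \<times> \<real>\<^sup>4\<close> with the
  form \<open>K dx\<^sub>0\<^sup>2 + dx\<^sup>2\<close>: the image lies in the unit 4-sphere for \<open>K = 1\<close>, in the hyperboloid for
  \<open>K = -1\<close>, and in an affine hyperplane isometric to \<open>\<real>\<^sup>4\<close> for \<open>K = 0\<close>.\<close>

lemma umbilic_immersion_warped_product:
  fixes \<phi> :: "real^4 \<Rightarrow> real \<times> (real^4)" and Df :: "nat \<Rightarrow> real \<Rightarrow> real"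
  assumes lp: "local_parametrization (J \<times> S3) U \<phi>"
    and K: "K \<in> {-1, 0, 1}"
    and Df: "\<And>n t. t \<in> J \<Longrightarrow> (Df n has_real_derivative Df (Suc n) t) (at t)"
    and pos: "\<And>t. t \<in> J \<Longrightarrow> Df 0 t > 0"
    and eq1: "\<And>t. t \<in> J \<Longrightarrow> (Df 1 t)\<^sup>2 = 1 - K * (Df 0 t)\<^sup>2"
    and eq2: "\<And>t. t \<in> J \<Longrightarrow> Df 2 t = - K * Df 0 t"
  shows "umbilic_immersion U (\<lambda>x. (Df 1 (fst (\<phi> x)), Df 0 (fst (\<phi> x)) *\<^sub>R snd (\<phi> x)))
     (\<lambda>v w. K * (fst v * fst w) + snd v \<bullet> snd w)
     (metric_coeffs (space_time_metric (round_family (Df 0))) \<phi>) K"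
proof (rule umbilic_immersion.intro)
  let ?F = "\<lambda>x. (Df 1 (fst (\<phi> x)), Df 0 (fst (\<phi> x)) *\<^sub>R snd (\<phi> x))"
  let ?B = "\<lambda>v w :: real \<times> (real^4). K * (fst v * fst w) + snd v \<bullet> snd w"
  let ?g = "space_time_metric (round_family (Df 0))"
  let ?G = "metric_coeffs ?g \<phi>"
  let ?d = "\<lambda>x. frechet_derivative \<phi> (at x)"
  let ?t = "\<lambda>x. fst (\<phi> x)" and ?p = "\<lambda>x. snd (\<phi> x)"
  note lpD = local_parametrizationD[OF lp]
  note d = smooth_on_has_derivative[OF lpD(2)]
  show "open U" by (rule lpD(1))
  have tp: "?t x \<in> J" "norm (?p x) = 1" if "x \<in> U" for x
    using lpD(4)[OF that] by (auto simp: mem_Times_iff)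
  have st: "smooth_on U ?t" and sp: "smooth_on U ?p"
    by (rule smooth_on_bounded_linear[OF lpD(1) _ lpD(2)], rule bounded_linear_fst bounded_linear_snd)+
  have sD: "smooth_on U (\<lambda>x. Df n (?t x))" for n
    using smooth_on_compose_real[of U ?t Df n, OF lpD(1) st] Df tp by simp
  show sF: "smooth_on U ?F"
    by (rule smooth_on_Pair[OF lpD(1) sD smooth_on_scaleR[OF lpD(1) sD sp]])
  show "bounded_bilinear ?B"
    unfolding bilinear_conv_bounded_bilinear[symmetric] bilinear_def
    by (auto intro!: linearI simp: inner_add_left inner_add_right algebra_simps)
  show "?B v w = ?B w v" for v w by (simp add: inner_commute mult.commute)
  fix x assume x: "x \<in> U"
  note J = tp(1)[OF x]
  have pp: "?p x \<bullet> ?p x = 1" using tp(2)[OF x] by (simp add: dot_square_norm)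
  have po: "?p x \<bullet> snd (?d x u) = 0" for u
    by (rule frechet_derivative_sphere[OF lpD(1) x bounded_linear.has_derivative[OF bounded_linear_snd d[OF x]] tp(2)])
  then have po': "snd (?d x u) \<bullet> ?p x = 0" for u by (simp only: inner_commute)
  have F': "frechet_derivative ?F (at x) u = (Df 2 (?t x) * fst (?d x u),
      (Df 1 (?t x) * fst (?d x u)) *\<^sub>R ?p x + Df 0 (?t x) *\<^sub>R snd (?d x u))" for u
  proof -
    have dt: "((\<lambda>x. Df n (?t x)) has_derivative (\<lambda>u. Df (Suc n) (?t x) * fst (?d x u))) (at x)" for n
      using has_derivative_compose[OF bounded_linear.has_derivative[OF bounded_linear_fst d[OF x]]
          Df[OF J, of n, unfolded has_field_derivative_def]] .
    have "(?F has_derivative (\<lambda>u. (Df (Suc 1) (?t x) * fst (?d x u),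
        Df 0 (?t x) *\<^sub>R snd (?d x u) + (Df (Suc 0) (?t x) * fst (?d x u)) *\<^sub>R ?p x))) (at x)"
      by (rule has_derivative_Pair[OF dt has_derivative_scaleR[OF dt
          bounded_linear.has_derivative[OF bounded_linear_snd d[OF x]]]])
    from fun_cong[OF frechet_derivative_at[OF this], of u] show ?thesis
      by (simp add: numeral_2_eq_2 add.commute)
  qed
  \<comment> \<open>The only use of the three admissible values in \<open>isom\<close>: the first
    component of the derivative is \<open>- K f\<close> times the time component, so the form
    contributes \<open>K^3 * f^2\<close>.\<close>
  have K3: "K * (K * K) = K" using K by auto
  have isom: "?B (frechet_derivative ?F (at x) u) (frechet_derivative ?F (at x) v)
      = ?g (\<phi> x) (?d x u) (?d x v)" for u v
  proof -
    have "?B (frechet_derivative ?F (at x) u) (frechet_derivative ?F (at x) v)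
      = (K * (K * K) * (Df 0 (?t x))\<^sup>2 + (Df 1 (?t x))\<^sup>2) * (fst (?d x u) * fst (?d x v))
        + (Df 0 (?t x))\<^sup>2 * (snd (?d x u) \<bullet> snd (?d x v))"
      unfolding F' eq2[OF J]
      by (simp add: inner_add_left inner_add_right pp po po' power2_eq_square)
        (simp add: algebra_simps)
    then show ?thesis
      unfolding space_time_metric_round_family K3 eq1[OF J] by simp
  qed
  show "?G x $ i $ j = ?B (partial_derivative i ?F x) (partial_derivative j ?F x)" for i j
    using isom by (simp only: metric_coeffs_def partial_derivative_def vec_lambda_beta)
  show "v \<bullet> (?G x *v v) > 0" if "v \<noteq> 0" for v
  proof -
    have "bounded_bilinear (?g (\<phi> x))"
      unfolding bilinear_conv_bounded_bilinear[symmetric] bilinear_def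
      by (auto intro!: linearI simp: space_time_metric_round_family inner_add_left inner_add_right algebra_simps)
    from metric_coeffs_quadratic[of ?g \<phi> x v, OF this smooth_on_differentiable[OF lpD(2) x]]
    have e: "v \<bullet> (?G x *v v) = (fst (?d x v))\<^sup>2 + (Df 0 (?t x))\<^sup>2 * (snd (?d x v) \<bullet> snd (?d x v))"
      by (simp add: space_time_metric_round_family power2_eq_square)
    have "?d x v \<noteq> 0"
      using injD[OF lpD(3)[OF x], of v 0] that linear_0[OF has_derivative_linear[OF d[OF x]]] by auto
    then have "fst (?d x v) \<noteq> 0 \<or> snd (?d x v) \<noteq> 0" by (simp add: prod_eq_iff)
    then show ?thesis unfolding e using pos[OF J]
      by (auto intro: add_pos_nonneg add_nonneg_pos)
  qed
  show "K = 0 \<or> K * ?B (?F x) (?F x) = 1"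
  proof -
    have "K * ?B (?F x) (?F x) = K * K * (Df 1 (?t x))\<^sup>2 + K * (Df 0 (?t x))\<^sup>2"
      by (simp add: pp power2_eq_square algebra_simps)
    also have "\<dots> = K * K + (K - K * (K * K)) * (Df 0 (?t x))\<^sup>2"
      unfolding eq1[OF J] by (simp add: algebra_simps)
    finally show ?thesis unfolding K3 using K by auto
  qed
  fix v w :: "real \<times> (real^4)"
  assume vi: "\<And>i. ?B v (partial_derivative i ?F x) = 0" and vF: "K * ?B v (?F x) = 0"
  \<comment> \<open>To verify the radical condition, \<open>v\<close> is tested against two tangent
    vectors: the time direction, and the part of \<open>snd v\<close> tangent to the sphere. The
    latter forces \<open>snd v\<close> to be radial with coefficient \<open>\<mu>\<close>.\<close>
  define \<mu> where "\<mu> = snd v \<bullet> ?p x"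
  have rng: "range (?d x) = {w. (0, ?p x) \<bullet> w = 0}"
    by (rule range_eq_hyperplane[OF has_derivative_linear[OF d[OF x]] lpD(3)[OF x]])
       (use tp(2)[OF x] po in \<open>auto simp: inner_prod_def zero_prod_def\<close>)
  have B0: "?B v (frechet_derivative ?F (at x) u) = 0" for u
  proof -
    have "?B v (frechet_derivative ?F (at x) u) = (\<Sum>i\<in>UNIV. u $ i * ?B v (partial_derivative i ?F x))"
      unfolding frechet_derivative_eq_sum_partial[OF smooth_on_differentiable[OF sF x]]
      by (simp add: fst_sum snd_sum inner_sum_right sum_distrib_left sum.distrib algebra_simps)
    then show ?thesis by (simp only: vi) simp
  qed
  obtain u where u: "?d x u = (1, 0)"
  proof -
    have "(1, 0) \<in> range (?d x)" unfolding rng by (simp add: inner_prod_def)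
    then show ?thesis using that by (metis imageE)
  qed
  have radial: "K * (fst v * Df 2 (?t x)) + Df 1 (?t x) * \<mu> = 0"
    using B0[of u] unfolding F' u by (simp add: \<mu>_def)
  obtain u' where u': "?d x u' = (0, snd v - \<mu> *\<^sub>R ?p x)"
  proof -
    have "(0, snd v - \<mu> *\<^sub>R ?p x) \<in> range (?d x)"
      unfolding rng by (simp add: inner_prod_def inner_diff_right pp \<mu>_def inner_commute)
    then show ?thesis using that by (metis imageE)
  qed
  have "snd v \<bullet> (snd v - \<mu> *\<^sub>R ?p x) = 0"
    using B0[of u'] pos[OF J] unfolding F' u' by simp
  moreover have "?p x \<bullet> (snd v - \<mu> *\<^sub>R ?p x) = 0"
    by (simp add: inner_diff_right pp \<mu>_def inner_commute)
  ultimately have "(snd v - \<mu> *\<^sub>R ?p x) \<bullet> (snd v - \<mu> *\<^sub>R ?p x) = 0"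
    by (simp only: inner_diff_left[of "snd v"] inner_scaleR_left mult_zero_right diff_zero)
  then have sv: "snd v = \<mu> *\<^sub>R ?p x" by simp
  have pos_v: "K * K * fst v * Df 1 (?t x) + K * Df 0 (?t x) * \<mu> = 0"
    using vF by (simp add: \<mu>_def algebra_simps)
  \<comment> \<open>\<open>radial\<close> and \<open>pos_v\<close> are linear equations in
    \<open>fst v\<close> and \<open>\<mu>\<close>; weighting them with \<open>f'\<close> and
    \<open>f\<close> eliminates \<open>fst v\<close> and leaves \<open>f'^2 + K * f^2 = 1\<close> as
    the coefficient of \<open>\<mu>\<close>.\<close>
  have "\<mu> = ((Df 1 (?t x))\<^sup>2 + K * (Df 0 (?t x))\<^sup>2) * \<mu>"
    using eq1[OF J] by simp
  also have "\<dots> = Df 1 (?t x) * (K * (fst v * Df 2 (?t x)) + Df 1 (?t x) * \<mu>)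
      + Df 0 (?t x) * (K * K * fst v * Df 1 (?t x) + K * Df 0 (?t x) * \<mu>)"
    unfolding eq2[OF J] by (simp add: power2_eq_square algebra_simps)
  also have "\<dots> = 0" unfolding radial pos_v by simp
  finally have "\<mu> = 0" .
  \<comment> \<open>Only \<open>K * fst v\<close> vanishes, not \<open>fst v\<close>: for
    \<open>K = 0\<close> the first coordinate axis is the radical of the form.\<close>
  moreover from this have "K * fst v = 0"
    using radial pos[OF J] unfolding eq2[OF J] by auto
  ultimately show "?B v w = 0" using sv by (simp add: mult.assoc[symmetric])
qed

theorem theorem1:
  fixes K :: real and T :: ereal and f :: "real \<Rightarrow> real"
  assumes "K \<in> {-1, 0, 1}"
    and "0 < T"
    and "smooth_on_interval {t. 0 \<le> t \<and> ereal t < T} f"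
    and "\<And>t. 0 < t \<Longrightarrow> ereal t < T \<Longrightarrow> f t > 0"
    and "\<And>t. 0 < t \<Longrightarrow> ereal t < T \<Longrightarrow> ricci_scalar (round_family f t) - 4 * K \<ge> 0"
    and "\<And>t. 0 < t \<Longrightarrow> ereal t < T \<Longrightarrow>
           metric_rate (round_family f) t = sqrt (ricci_scalar (round_family f t) - 4 * K)"
    and "f 0 = 0"
    and "(f has_real_derivative 1) (at 0 within {t. 0 \<le> t \<and> ereal t < T})"
  shows "has_constant_sectional_curvature TYPE(4)
           ({t. 0 < t \<and> ereal t < T} \<times> S3) (space_time_metric (round_family f)) K"
proof -
  let ?I = "{t. 0 \<le> t \<and> ereal t < T}" and ?J = "{t. 0 < t \<and> ereal t < T}"
  obtain Df where Df0: "Df 0 = f"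
    and DfI: "\<And>n t. t \<in> ?I \<Longrightarrow> (Df n has_real_derivative Df (Suc n) t) (at t within ?I)"
    using assms(3) unfolding smooth_on_interval_def by blast
  have Df: "(Df n has_real_derivative Df (Suc n) t) (at t)" if "t \<in> ?J" for n t
  proof -
    have "at t within ?I = at t"
      by (rule at_within_open_subset[OF that open_time_interval]) auto
    then show ?thesis using DfI[of t n] that by simp
  qed
  have eq1: "Df 1 t \<ge> 0 \<and> (Df 1 t)\<^sup>2 = 1 - K * (f t)\<^sup>2" if "t \<in> ?J" for t
  proof -
    have t: "0 < t" "ereal t < T" using that by auto
    note pos = assms(4)[OF t]
    have rate: "2 * Df 1 t / f t = sqrt (4 / (f t)\<^sup>2 - 4 * K)"
      using assms(6)[OF t] metric_rate_round_family[of f t, OF pos] Df[OF that, of 0]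
        ricci_scalar_round_family[of f t, OF pos] Df0 by simp
    \<comment> \<open>The real \<open>sqrt\<close> is odd, so a nonnegative argument is what gives
      both the sign of \<open>Df 1 t\<close> and the square of the flow equation.\<close>
    have nonneg: "4 / (f t)\<^sup>2 - 4 * K \<ge> 0"
      using assms(5)[OF t] ricci_scalar_round_family[of f t, OF pos] by simp
    have "2 * Df 1 t / f t \<ge> 0" unfolding rate using nonneg by simp
    then have "Df 1 t \<ge> 0" using pos by (simp add: zero_le_divide_iff)
    moreover have "(2 * Df 1 t / f t)\<^sup>2 = 4 / (f t)\<^sup>2 - 4 * K"
      unfolding rate using nonneg by simp
    then have "(Df 1 t)\<^sup>2 = 1 - K * (f t)\<^sup>2"
      using pos by (simp add: power_divide power_mult_distrib field_simps)
    ultimately show ?thesis by simp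
  qed
  have eq2: "Df 2 t = - K * f t" if "t \<in> ?J" for t
  proof (rule warping_function_second_derivative[OF assms(1,2), of f "Df 1"])
    show "(f has_real_derivative Df 1 t) (at t)" if "0 < t" "ereal t < T" for t
      using Df[of t 0] that Df0 by simp
    show "(Df 1 has_real_derivative Df 2 t) (at t)" if "0 < t" "ereal t < T" for t
      using Df[of t 1] that by (simp add: numeral_2_eq_2)
    show "continuous_on ?J (Df 2)"
      using Df[THEN DERIV_isCont] by (intro continuous_at_imp_continuous_on ballI)
    show "continuous (at 0 within ?I) f"
      using DfI[of 0 0] Df0 assms(2) by (auto intro: DERIV_continuous simp: zero_ereal_def)
    show "Df 1 t \<ge> 0 \<and> (Df 1 t)\<^sup>2 = 1 - K * (f t)\<^sup>2" if "0 < t" "ereal t < T" for t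
      using eq1 that by blast
  qed (use that assms in auto)
  have um: "umbilic_immersion U (\<lambda>x. (Df 1 (fst (\<phi> x)), Df 0 (fst (\<phi> x)) *\<^sub>R snd (\<phi> x)))
     (\<lambda>v w. K * (fst v * fst w) + snd v \<bullet> snd w) (metric_coeffs (space_time_metric (round_family f)) \<phi>) K"
    if "local_parametrization (?J \<times> S3) U \<phi>" for U and \<phi> :: "real^4 \<Rightarrow> real \<times> (real^4)"
    using umbilic_immersion_warped_product[of ?J U \<phi> K Df, OF that assms(1) Df]
      assms(4) eq1 eq2 unfolding Df0 by blast
  show ?thesis
    unfolding has_constant_sectional_curvature_def riemannian_metric_on_def
  proof (intro conjI allI impI ballI)
    fix U and \<phi> :: "real^4 \<Rightarrow> real \<times> (real^4)"
    assume lp: "local_parametrization (?J \<times> S3) U \<phi>"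
    interpret umbilic_immersion U "\<lambda>x. (Df 1 (fst (\<phi> x)), Df 0 (fst (\<phi> x)) *\<^sub>R snd (\<phi> x))"
      "\<lambda>v w. K * (fst v * fst w) + snd v \<bullet> snd w" "metric_coeffs (space_time_metric (round_family f)) \<phi>" K
      by (rule um[OF lp])
    \<comment> \<open>The locale gives smoothness entry by entry; \<open>smooth_on_matrix\<close>
      assembles the matrix-valued map.\<close>
    show "smooth_on U (metric_coeffs (space_time_metric (round_family f)) \<phi>)"
      using smooth_on_matrix[of U "\<lambda>i j x. metric_coeffs (space_time_metric (round_family f)) \<phi> x $ i $ j",
          OF open_U smooth_G] by simp
    fix x assume x: "x \<in> U"
    show "transpose (metric_coeffs (space_time_metric (round_family f)) \<phi> x)
        = metric_coeffs (space_time_metric (round_family f)) \<phi> x"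
      using G_commute[OF x] by (simp add: transpose_def vec_eq_iff)
    show "v \<bullet> (metric_coeffs (space_time_metric (round_family f)) \<phi> x *v v) > 0" if "v \<noteq> 0" for v
      by (rule G_pos[OF x that])
    show "sectional_curvature (metric_coeffs (space_time_metric (round_family f)) \<phi>) x u v = K"
      if "u \<noteq> v \<and> independent {u, v}" for u v
      using sectional_curvature_eq[OF x] that by blast
  qed
qed

end
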